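(* Let $(\mathcal L;\leq,\odot,1)$ be a non-trivial q.n.c. tomonoid, let $F$ be a non-trivial Archimedean filter of $\mathcal L$ such that each $F$-class is order-isomorphic to a real interval, and let $\mathcal P$ be the quotient of $\mathcal L$ by $F$. Let $F$ not have a smallest element. Let $R,T\in\mathcal P$, where $T<F$, be a $\odot$-maximal pair, and let $S=R\odot T$. Write $\kappa=\frac{\alpha_S}{\alpha_R}$. (i) Let $\Lambda^R$ and $\Lambda^S$ be Łukasiewicz. Then, under the identification of $R$ and $S$ with $[0,1]$, $\Lambda^{R,S}$ consists of the mappings \[ \lambda_z\colon[0,1]\to[0,1],\quad r\mapsto(\kappa r+z)\vee0, \] where $-\kappa\leq z\leq m$ for some $m\in[-\kappa,(1-\kappa)\wedge0]$. (ii) Let $\Lambda^R$ be Łukasiewicz and $\Lambda^S$ reversed product. Then, under the identification of $R$ and $S$ with $[0,1]$ and $[0,1)$, respectively, $\Lambda^{R,S}$ consists of the mappings \[ \lambda_z\colon[0,1]\to[0,1),\quad r\mapsto(1-e^{-\kappa(r+z)})\vee0, \] where $-1\leq z\leq m$ for some $m\in[-1,0]$. (iii) Let $\Lambda^R$ be product and $\Lambda^S$ Łukasiewicz. Then, under the identification of $R$ and $S$ with $(0,1]$ and $[0,1]$, respectively, $\Lambda^{R,S}$ consists of the mappings \[ \lambda_z\colon(0,1]\to[0,1],\quad r\mapsto(\kappa\ln r+z)\vee0, \] where $0\leq z\leq m$ for some $m\in[0,1]$. (iv) Let $\Lambda^R$ and $\Lambda^S$ be product. Then, under the identification of $R$ and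 $S$ with $(0,1]$, $\Lambda^{R,S}$ consists of the mappings \[ \lambda_z\colon(0,1]\to(0,1],\quad r\mapsto z\,r^{\kappa}, \] where $0<z\leq m$ for some $m\in(0,1]$. (v) Let $\Lambda^R$ be product and $\Lambda^S$ reversed product. Then, under the identification of $R$ and $S$ with $(0,1]$ and $[0,1)$, respectively, $\Lambda^{R,S}$ consists of the mappings \[ \lambda_z\colon(0,1]\to[0,1),\quad r\mapsto\Bigl(1-\frac1{z\,r^{\kappa}}\Bigr)\vee0, \] where either $z$ ranges over all $z\geq1$, or over $1\leq z\leq m$ for some $m\geq1$. (vi) Let $\Lambda^R$ be product and $\Lambda^S$ power. Then, under the identification of $R$ and $S$ with $(0,1]$ and $(0,1)$, respectively, $\Lambda^{R,S}$ consists of the mappings \[ \lambda_z\colon(0,1]\to(0,1),\quad r\mapsto z^{(r^{-\kappa})}, \] where either $z$ ranges over all $0<z<1$, or over $0<z\leq m$ for some $m\in(0,1)$. (vii) Let $\Lambda^R$ and $\Lambda^S$ be reversed product. Then, under the identification of $R$ and $S$ with $[0,1)$, $\Lambda^{R,S}$ is either trivial or contained in the set of mappings \[ \lambda_z\colon[0,1)\to[0,1),\quad r\mapsto\Bigl(1-\frac{(1-r)^{\kappa}}z\Bigr)\vee0, \] where $0<z\leq m$ for some $m\in(0,1]$. (viii) Let $\Lambda^R$ be power and $\Lambda^S$ reversed product. Then, under the identification of $R$ and $S$ with $(0,1)$ and $[0,1)$, respectively, $\Lambda^{R,S}$ is either trivial or contained in the set of mappings \[ \lambda_z\colon(0,1)\to[0,1),\quad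 r\mapsto\Bigl(1-\frac{(-\ln r)^{\kappa}}z\Bigr)\vee0, \] where either $z$ ranges over all $z>0$, or over $0<z\leq m$ for some $m>0$. (ix) Let $\Lambda^R$ and $\Lambda^S$ be power. Then, under the identification of $R$ and $S$ with $(0,1)$, $\Lambda^{R,S}$ consists of the mappings \[ \lambda_z\colon(0,1)\to(0,1),\quad r\mapsto z^{((-\ln r)^{\kappa})}, \] where either $z$ ranges over all $0<z<1$, or over $0<z\leq m$ for some $m\in(0,1)$.
   Context: For reals, $\wedge,\vee$ denote minimum and maximum. "Consists of the mappings $\lambda_z$, where $z$ ..." means that $\Lambda^{R,S}$ equals the set of these mappings for all $z$ in the stated range. Tomonoids. A tomonoid is a structure $(\mathcal L;\leq,\odot,1)$ where $(\mathcal L;\odot,1)$ is a monoid and $\leq$ is a total order such that $a\leq b$, $c\leq d$ imply $a\odot c\leq b\odot d$. It is commutative if $\odot$ is; negative if $a\leq 1$ for all $a$; quantic if every non-empty subset has a supremum and $a\odot\bigvee_\iota b_\iota=\bigvee_\iota(a\odot b_\iota)$, $(\bigvee_\iota b_\iota)\odot a=\bigvee_\iota(b_\iota\odot a)$ for all $a$ and all non-empty families $(b_\iota)$. "q.n.c." means quantic, negative, commutative. A tomonoid is trivial if it consists of $1$ alone. It is Archimedean if for all $a<b<1$ there is $n\geq1$ with $b^n\leq a$. Filters and quotients. A filter of $\mathcal L$ is a subset $F\ni 1$ closed under $\odot$ and upward closed, regarded as a tomonoid with the restricted structure; it is non-trivial if $F\neq\{1\}$. The congruence induced by $F$: $a\sim_F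 b$ iff $a=b$, or $a<b$ and $b\odot f\leq a$ for some $f\in F$, or $b<a$ and $a\odot f\leq b$ for some $f\in F$. Its classes, which are intervals of $\mathcal L$, are the $F$-classes; the quotient $\mathcal P$ of $\mathcal L$ by $F$ is the set of $F$-classes, ordered by $R\leq S$ iff $a\leq b$ for some $a\in R,b\in S$, with the induced product $\odot$ and identity (top element) $F$; it is again q.n.c. A real interval is a singleton or a set $(a,b),(a,b],[a,b)$ or $[a,b]$ with $a<b$ in $\mathbb R$. A pair $R,T\in\mathcal P$ with $S=R\odot T$ is $\odot$-maximal if $R$ is the largest $X\in\mathcal P$ with $X\odot T=S$ and $T$ is the largest $Y\in\mathcal P$ with $R\odot Y=S$. Translations. For $a\in\mathcal L$ let $\lambda_a\colon\mathcal L\to\mathcal L$, $x\mapsto a\odot x$. For an $F$-class $R$ and $f\in F$, let $\lambda_f^R\colon R\to R$ be the restriction of $\lambda_f$; $\Lambda^R=\{\lambda^R_f : f\in F\}$, and $\varrho_R\colon F\to\Lambda^R$, $f\mapsto\lambda^R_f$. For $F$-classes $R,T$ with $T\neq F$ and $S=R\odot T$, let $\lambda_t^{R,S}\colon R\to S$ be the restriction of $\lambda_t$ ($t\in T$), and $\Lambda^{R,S}=\{\lambda_t^{R,S}:t\in T\}$. $\Lambda^{R,S}$ is trivial if $S$ has a bottom element $p$ and $\Lambda^{R,S}$ consists of the single constant map $R\to S$ with value $p$. Composition tomonoids. A composition tomonoid on a chain $R$ is a set $\Phi$ of order-preserving maps $R\to R$ that is totally ordered by the pointwise order, closed under composition,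 and contains $\mathrm{id}_R$. $\Phi$ on $R$ and $\Psi$ on $S$ are c-isomorphic if there is an order isomorphism $\phi\colon R\to S$ with $\Psi=\{\phi\circ\lambda\circ\phi^{-1}:\lambda\in\Phi\}$. A composition tomonoid is called: Łukasiewicz if c-isomorphic to $\{[0,1]\to[0,1],\,x\mapsto(x+t-1)\vee0 : t\in[0,1]\}$; product if c-isomorphic to $\{(0,1]\to(0,1],\,x\mapsto tx : t\in(0,1]\}$; reversed product if c-isomorphic to $\{[0,1)\to[0,1),\,x\mapsto\frac{(x+t-1)\vee0}{t}: t\in(0,1]\}$; power if c-isomorphic to $\{(0,1)\to(0,1),\,x\mapsto x^{1/t}: t\in(0,1]\}$. Identifications and coefficients. Since $F$ has no smallest element, $F$ is isomorphic as a tomonoid to $((0,1];\leq,\cdot,1)$ (known fact); $F$ is identified with $(0,1]$ by such an isomorphism. An $F$-class $Q$ for which $\Lambda^Q$ is of one of the four types is identified with $[0,1]$, $(0,1]$, $[0,1)$ or $(0,1)$ (Łukasiewicz, product, reversed product, power, respectively) by means of an order isomorphism that is a c-isomorphism from $\Lambda^Q$ to the respective canonical composition tomonoid. Under these identifications there is a coefficient $\alpha_Q>0$ such that for $f\in F$, $\varrho_Q(f)$ is the map $r\mapsto(r+\alpha_Q\ln f)\vee0$ (Łukasiewicz), $r\mapsto f^{\alpha_Q}r$ (product), $r\mapsto\bigl(1-\frac{1-r}{f^{\alpha_Q}}\bigr)\vee0$ (reversed product), $r\mapsto r^{1/f^{\alpha_Q}}$ (power), respectively. The numbers $\alpha_R,\alpha_S$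 are these coefficients for $Q=R$ and $Q=S$. *)

theory Defs
  imports Complex_Main "HOL-Library.FuncSet"
begin

section \<open>Tomonoids\<close>

definition (in ord) is_supremum :: "'a set \<Rightarrow> 'a \<Rightarrow> bool" where
  "is_supremum B s \<longleftrightarrow> (\<forall>b\<in>B. b \<le> s) \<and> (\<forall>u. (\<forall>b\<in>B. b \<le> u) \<longrightarrow> s \<le> u)"

class tomonoid = linorder + monoid_mult +
  assumes tomonoid_mult_mono: "a \<le> b \<Longrightarrow> c \<le> d \<Longrightarrow> a * c \<le> b * d"

class quantic_tomonoid = tomonoid +
  assumes ex_supremum: "B \<noteq> {} \<Longrightarrow> \<exists>s. is_supremum B s"
    and mult_supremum_left:
      "B \<noteq> {} \<Longrightarrow> is_supremum B s \<Longrightarrow> is_supremum ((\<lambda>b. a * b) ` B) (a * s)"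
    and mult_supremum_right:
      "B \<noteq> {} \<Longrightarrow> is_supremum B s \<Longrightarrow> is_supremum ((\<lambda>b. b * a) ` B) (s * a)"

class qnc_tomonoid = quantic_tomonoid + comm_monoid_mult +
  assumes negative: "a \<le> 1"


section \<open>Order isomorphisms and real intervals\<close>

definition order_isomorphism :: "('a::linorder \<Rightarrow> 'b::linorder) \<Rightarrow> 'a set \<Rightarrow> 'b set \<Rightarrow> bool" where
  "order_isomorphism \<phi> A B \<longleftrightarrow>
     bij_betw \<phi> A B \<and> (\<forall>x\<in>A. \<forall>y\<in>A. x \<le> y \<longleftrightarrow> \<phi> x \<le> \<phi> y)"

definition real_interval :: "real set \<Rightarrow> bool" where
  "real_interval I \<longleftrightarrow>
     (\<exists>a. I = {a}) \<or>
     (\<exists>a b. a < b \<and> (I = {a<..<b} \<or> I = {a<..b} \<or> I = {a..<b} \<or> I = {a..b}))"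


section \<open>Filters and quotients\<close>

definition tomonoid_filter :: "'a::tomonoid set \<Rightarrow> bool" where
  "tomonoid_filter F \<longleftrightarrow>
     1 \<in> F \<and> (\<forall>a\<in>F. \<forall>b\<in>F. a * b \<in> F) \<and> (\<forall>a\<in>F. \<forall>b. a \<le> b \<longrightarrow> b \<in> F)"

definition archimedean_filter :: "'a::tomonoid set \<Rightarrow> bool" where
  "archimedean_filter F \<longleftrightarrow>
     (\<forall>a\<in>F. \<forall>b\<in>F. a < b \<and> b < 1 \<longrightarrow> (\<exists>n\<ge>1. b ^ n \<le> a))"

definition filter_cong :: "'a::tomonoid set \<Rightarrow> ('a \<times> 'a) set" where
  "filter_cong F =
     {(a, b). a = b \<or> (a < b \<and> (\<exists>f\<in>F. b * f \<le> a)) \<or> (b < a \<and> (\<exists>f\<in>F. a * f \<le> b))}"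

definition filter_classes :: "'a::tomonoid set \<Rightarrow> 'a set set" where
  "filter_classes F = UNIV // filter_cong F"

definition class_le :: "'a::tomonoid set \<Rightarrow> 'a set \<Rightarrow> bool" where
  "class_le R S \<longleftrightarrow> (\<exists>a\<in>R. \<exists>b\<in>S. a \<le> b)"

definition class_less :: "'a::tomonoid set \<Rightarrow> 'a set \<Rightarrow> bool" where
  "class_less R S \<longleftrightarrow> class_le R S \<and> R \<noteq> S"

text \<open>As usual for operations lifted to a quotient, the union is over one and the same class.\<close>

definition class_mult :: "'a::tomonoid set \<Rightarrow> 'a set \<Rightarrow> 'a set \<Rightarrow> 'a set" where
  "class_mult F R T = (\<Union>a\<in>R. \<Union>b\<in>T. filter_cong F `` {a * b})"

definition maximal_pair :: "'a::tomonoid set \<Rightarrow> 'a set \<Rightarrow> 'a set \<Rightarrow> bool" where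
  "maximal_pair F R T \<longleftrightarrow>
     R \<in> filter_classes F \<and> T \<in> filter_classes F \<and>
     (\<forall>X\<in>filter_classes F. class_mult F X T = class_mult F R T \<longrightarrow> class_le X R) \<and>
     (\<forall>Y\<in>filter_classes F. class_mult F R Y = class_mult F R T \<longrightarrow> class_le Y T)"


section \<open>Translations\<close>

text \<open>
  Maps on a chain \<open>R\<close> are represented by functions that are \<open>undefined\<close> outside \<open>R\<close>
  (\<open>restrict\<close>, \<open>extensional\<close>), so that equality of sets of maps is meaningful.

  \<open>Lambda_maps T R\<close> is the set \<open>\<Lambda>\<^sup>R\<^sup>,\<^sup>S\<close> for \<open>S\<close> the product of the classes \<open>R\<close> and \<open>T\<close>;
  with the filter \<open>F\<close> in place of \<open>T\<close> it is \<open>\<Lambda>\<^sup>R\<close>.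
\<close>

definition translation :: "'a::tomonoid set \<Rightarrow> 'a \<Rightarrow> 'a \<Rightarrow> 'a" where
  "translation R t = (\<lambda>x\<in>R. t * x)"

definition Lambda_maps :: "'a::tomonoid set \<Rightarrow> 'a set \<Rightarrow> ('a \<Rightarrow> 'a) set" where
  "Lambda_maps T R = translation R ` T"

definition trivial_translations :: "'a::tomonoid set \<Rightarrow> 'a set \<Rightarrow> 'a set \<Rightarrow> bool" where
  "trivial_translations T R S \<longleftrightarrow>
     (\<exists>p\<in>S. (\<forall>s\<in>S. p \<le> s) \<and> Lambda_maps T R = {\<lambda>x\<in>R. p})"


section \<open>Composition tomonoids\<close>

definition composition_tomonoid :: "'a::linorder set \<Rightarrow> ('a \<Rightarrow> 'a) set \<Rightarrow> bool" where
  "composition_tomonoid R \<Phi> \<longleftrightarrow>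
     (\<forall>g\<in>\<Phi>. g \<in> R \<rightarrow>\<^sub>E R \<and> mono_on R g) \<and>
     (\<forall>g\<in>\<Phi>. \<forall>h\<in>\<Phi>. (\<forall>x\<in>R. g x \<le> h x) \<or> (\<forall>x\<in>R. h x \<le> g x)) \<and>
     (\<forall>g\<in>\<Phi>. \<forall>h\<in>\<Phi>. compose R g h \<in> \<Phi>) \<and>
     (\<lambda>x\<in>R. x) \<in> \<Phi>"

text \<open>
  \<open>transport R \<phi> R' \<psi> g\<close> is the map \<open>\<psi> \<circ> g \<circ> \<phi>\<^sup>-\<^sup>1\<close> with domain \<open>R'\<close>, where \<open>\<phi>\<close> is a bijection
  from \<open>R\<close> to \<open>R'\<close>.
\<close>

definition transport ::
    "'a set \<Rightarrow> ('a \<Rightarrow> 'c) \<Rightarrow> 'c set \<Rightarrow> ('b \<Rightarrow> 'd) \<Rightarrow> ('a \<Rightarrow> 'b) \<Rightarrow> 'c \<Rightarrow> 'd" where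
  "transport R \<phi> R' \<psi> g = (\<lambda>r\<in>R'. \<psi> (g (inv_into R \<phi> r)))"

definition c_isomorphism ::
    "('a::linorder \<Rightarrow> 'b::linorder) \<Rightarrow> 'a set \<Rightarrow> ('a \<Rightarrow> 'a) set \<Rightarrow> 'b set \<Rightarrow> ('b \<Rightarrow> 'b) set \<Rightarrow> bool" where
  "c_isomorphism \<phi> R \<Phi> S \<Psi> \<longleftrightarrow>
     order_isomorphism \<phi> R S \<and> \<Psi> = transport R \<phi> S \<phi> ` \<Phi>"

datatype ctype = Lukasiewicz | Product | ReversedProduct | Power

fun std_chain :: "ctype \<Rightarrow> real set" where
  "std_chain Lukasiewicz = {0..1}"
| "std_chain Product = {0<..1}"
| "std_chain ReversedProduct = {0..<1}"
| "std_chain Power = {0<..<1}"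

fun std_maps :: "ctype \<Rightarrow> (real \<Rightarrow> real) set" where
  "std_maps Lukasiewicz = {(\<lambda>x\<in>{0..1}. max (x + t - 1) 0) | t. t \<in> {0..1}}"
| "std_maps Product = {(\<lambda>x\<in>{0<..1}. t * x) | t. t \<in> {0<..1}}"
| "std_maps ReversedProduct = {(\<lambda>x\<in>{0..<1}. max (x + t - 1) 0 / t) | t. t \<in> {0<..1}}"
| "std_maps Power = {(\<lambda>x\<in>{0<..<1}. x powr (1 / t)) | t. t \<in> {0<..1}}"

definition has_ctype :: "ctype \<Rightarrow> 'a::linorder set \<Rightarrow> ('a \<Rightarrow> 'a) set \<Rightarrow> bool" where
  "has_ctype k R \<Phi> \<longleftrightarrow>
     composition_tomonoid R \<Phi> \<and> (\<exists>\<phi>. c_isomorphism \<phi> R \<Phi> (std_chain k) (std_maps k))"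


section \<open>Identifications and coefficients\<close>

definition filter_identification :: "'a::tomonoid set \<Rightarrow> ('a \<Rightarrow> real) \<Rightarrow> bool" where
  "filter_identification F \<iota> \<longleftrightarrow>
     order_isomorphism \<iota> F {0<..1} \<and> (\<forall>a\<in>F. \<forall>b\<in>F. \<iota> (a * b) = \<iota> a * \<iota> b) \<and> \<iota> 1 = 1"

definition class_identification ::
    "'a::tomonoid set \<Rightarrow> ctype \<Rightarrow> 'a set \<Rightarrow> ('a \<Rightarrow> real) \<Rightarrow> bool" where
  "class_identification F k Q \<phi> \<longleftrightarrow>
     c_isomorphism \<phi> Q (Lambda_maps F Q) (std_chain k) (std_maps k)"

text \<open>The action of \<open>f \<in> (0, 1]\<close> on the canonical chain, with coefficient \<open>\<alpha>\<close>.\<close>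

fun std_action :: "ctype \<Rightarrow> real \<Rightarrow> real \<Rightarrow> real \<Rightarrow> real" where
  "std_action Lukasiewicz \<alpha> f r = max (r + \<alpha> * ln f) 0"
| "std_action Product \<alpha> f r = f powr \<alpha> * r"
| "std_action ReversedProduct \<alpha> f r = max (1 - (1 - r) / f powr \<alpha>) 0"
| "std_action Power \<alpha> f r = r powr (1 / f powr \<alpha>)"

definition is_coefficient ::
    "'a::tomonoid set \<Rightarrow> ('a \<Rightarrow> real) \<Rightarrow> ctype \<Rightarrow> 'a set \<Rightarrow> ('a \<Rightarrow> real) \<Rightarrow> real \<Rightarrow> bool" where
  "is_coefficient F \<iota> k Q \<phi> \<alpha> \<longleftrightarrow>
     \<alpha> > 0 \<and>
     (\<forall>f\<in>F. transport Q \<phi> (std_chain k) \<phi> (translation Q f) =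
             (\<lambda>r\<in>std_chain k. std_action k \<alpha> (\<iota> f) r))"

text \<open>
  \<open>identified F \<iota> k Q \<phi> \<alpha>\<close>: the composition tomonoid on the class \<open>Q\<close> is of type \<open>k\<close>,
  \<open>Q\<close> is identified with the canonical chain by \<open>\<phi>\<close>, and \<open>\<alpha>\<close> is the resulting coefficient.
\<close>

definition identified ::
    "'a::tomonoid set \<Rightarrow> ('a \<Rightarrow> real) \<Rightarrow> ctype \<Rightarrow> 'a set \<Rightarrow> ('a \<Rightarrow> real) \<Rightarrow> real \<Rightarrow> bool" where
  "identified F \<iota> k Q \<phi> \<alpha> \<longleftrightarrow>
     has_ctype k Q (Lambda_maps F Q) \<and> class_identification F k Q \<phi> \<and>
     is_coefficient F \<iota> k Q \<phi> \<alpha>"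

text \<open>
  The set \<open>\<Lambda>\<^sup>R\<^sup>,\<^sup>S\<close> when \<open>R\<close> is identified by \<open>\<phi>\<close> with the canonical chain of type \<open>k\<close>,
  and \<open>S\<close> is identified by \<open>\<psi>\<close> with a set of reals.
\<close>

definition real_translations ::
    "ctype \<Rightarrow> 'a::tomonoid set \<Rightarrow> 'a set \<Rightarrow> ('a \<Rightarrow> real) \<Rightarrow> ('a \<Rightarrow> real) \<Rightarrow> (real \<Rightarrow> real) set" where
  "real_translations k T R \<phi> \<psi> = transport R \<phi> (std_chain k) \<psi> ` Lambda_maps T R"

end

theory Submission
  imports Defs
begin

text \<open>
  The commutative multiplication makes every translation \<open>R \<rightarrow> S\<close> by an element of \<open>T\<close> commute
  with the action of the filter \<open>F\<close> on \<open>R\<close> and on \<open>S\<close>, and this nearly determines it. The point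
  is to choose coordinates in which the four types of action look alike. In the coordinates
  \<open>r\<close> (Lukasiewicz), \<open>ln r\<close> (product), \<open>- ln (1 - r)\<close> (reversed product) and
  \<open>- ln (- ln r)\<close> (power), a class becomes the interval \<open>[0, 1]\<close>, \<open>(-\<infinity>, 0]\<close>, \<open>[0, \<infinity>)\<close> or
  the whole real line, and \<open>f \<in> F\<close> acts as \<open>u \<mapsto> u - \<alpha> * (- ln f)\<close>, cut off at the
  bottom element \<open>0\<close> in the first and third case (\<open>linear_chart_identified\<close>).

  Commuting with such actions means having slope \<open>\<kappa> = \<alpha>\<^sub>S / \<alpha>\<^sub>R\<close> up to the cut-off: the value
  of a translation at \<open>p\<close> determines its values below \<open>p\<close> (\<open>translation_below\<close>). Hence, if
  \<open>R\<close> has a top element \<open>p\<close>, or if \<open>S\<close> has no bottom element and \<open>p\<close> is arbitrary, the set of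
  translations is described by the set \<open>Z\<close> of their values at \<open>p\<close>. Multiplying by elements of
  \<open>F\<close> shows that \<open>Z\<close> is a down-set. Either \<open>T\<close> has a largest element, and then so has \<open>Z\<close>; or
  the supremum of \<open>T\<close> belongs to a strictly larger class, and then, by maximality of the pair and
  since multiplication preserves suprema, \<open>Z\<close> is not bounded in \<open>S\<close>, hence is the whole
  chain (\<open>values_at_point\<close>). A bottom element of \<open>R\<close>, being fixed by \<open>F\<close>, must be mapped to a
  bottom element of \<open>S\<close>, which yields the additional bounds on the parameter
  (\<open>translation_bottom\<close>).

  If \<open>R\<close> has no top element but \<open>S\<close> has a bottom element, translations may also be constant. As
  any two elements of \<open>T\<close> differ by at most the action of some \<open>f \<in> F\<close>, either all of them are
  constant or all have the form \<open>u \<mapsto> max (\<kappa> * u + c) 0\<close> (\<open>translation_topless\<close>).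

  What remains is to rewrite the resulting families in the original coordinates.
\<close>


section \<open>Classes of a filter\<close>

lemma mult_le_right: "a * b \<le> (a::'a::qnc_tomonoid)"
  using tomonoid_mult_mono[of a a b 1] negative[of b] by simp

lemma mult_le_left: "a * b \<le> (b::'a::qnc_tomonoid)"
  using mult_le_right[of b a] by (simp add: mult.commute)

text \<open>By negativity, the case distinction in \<open>filter_cong\<close> can be replaced by a symmetric condition.\<close>

lemma filter_cong_iff:
  fixes F :: "'a::qnc_tomonoid set"
  assumes "tomonoid_filter F"
  shows "(a, b) \<in> filter_cong F \<longleftrightarrow> (\<exists>f\<in>F. a * f \<le> b \<and> b * f \<le> a)"
proof
  assume "(a, b) \<in> filter_cong F"
  then consider "a = b" | f where "a < b" "f \<in> F" "b * f \<le> a"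
    | f where "b < a" "f \<in> F" "a * f \<le> b"
    unfolding filter_cong_def by auto
  then show "\<exists>f\<in>F. a * f \<le> b \<and> b * f \<le> a"
  proof cases
    case 1
    then show ?thesis using mult_le_right by (metis assms tomonoid_filter_def)
  next
    case 2
    then show ?thesis using mult_le_right[of a f] by (metis le_less_trans less_imp_le)
  next
    case 3
    then show ?thesis using mult_le_right[of b f] by (metis le_less_trans less_imp_le)
  qed
next
  assume "\<exists>f\<in>F. a * f \<le> b \<and> b * f \<le> a"
  then show "(a, b) \<in> filter_cong F"
    unfolding filter_cong_def by (cases a b rule: linorder_cases) auto
qed

lemma equiv_filter_cong:
  fixes F :: "'a::qnc_tomonoid set"
  assumes F: "tomonoid_filter F"
  shows "equiv UNIV (filter_cong F)"
proof (rule equivI)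
  show "refl (filter_cong F)"
    by (auto simp: refl_on_def filter_cong_def)
  show "sym (filter_cong F)"
    by (auto simp: sym_def filter_cong_def)
  show "trans (filter_cong F)"
  proof (rule transI)
    fix a b c assume "(a, b) \<in> filter_cong F" "(b, c) \<in> filter_cong F"
    then obtain f g where fg: "f \<in> F" "a * f \<le> b" "b * f \<le> a" "g \<in> F" "b * g \<le> c" "c * g \<le> b"
      unfolding filter_cong_iff[OF F] by blast
    have "a * (f * g) \<le> c"
      using tomonoid_mult_mono[OF fg(2) order_refl[of g]] fg(5) by (simp add: mult.assoc)
    moreover have "c * (f * g) \<le> a"
      using tomonoid_mult_mono[OF fg(6) order_refl[of f]] fg(3)
      by (simp add: mult.assoc mult.commute[of g])
    moreover have "f * g \<in> F"
      using F fg unfolding tomonoid_filter_def by blast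
    ultimately show "(a, c) \<in> filter_cong F"
      unfolding filter_cong_iff[OF F] by blast
  qed
qed (auto simp: filter_cong_def)

lemma filter_cong_mult:
  fixes F :: "'a::qnc_tomonoid set"
  assumes F: "tomonoid_filter F" and "(a, b) \<in> filter_cong F" "(c, d) \<in> filter_cong F"
  shows "(a * c, b * d) \<in> filter_cong F"
proof -
  have *: "(x * z, y * z) \<in> filter_cong F" if xy: "(x, y) \<in> filter_cong F" for x y z
  proof -
    obtain f where "f \<in> F" "x * f \<le> y" "y * f \<le> x"
      using xy unfolding filter_cong_iff[OF F] by blast
    then show ?thesis
      unfolding filter_cong_iff[OF F]
      using tomonoid_mult_mono[of "x * f" y z z] tomonoid_mult_mono[of "y * f" x z z]
      by (auto simp: mult.assoc mult.commute[of z] intro!: bexI[of _ f])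
  qed
  have "(a * c, b * c) \<in> filter_cong F" "(b * c, b * d) \<in> filter_cong F"
    using *[OF assms(2), of c] *[OF assms(3), of b] by (simp_all add: mult.commute)
  then show ?thesis
    using equivE[OF equiv_filter_cong[OF F]] by (meson transD)
qed

lemma filter_cong_convex:
  fixes F :: "'a::qnc_tomonoid set"
  assumes F: "tomonoid_filter F" and "(a, c) \<in> filter_cong F" "a \<le> b" "b \<le> c"
  shows "(a, b) \<in> filter_cong F"
proof -
  obtain f where f: "f \<in> F" "c * f \<le> a"
    using assms(2) unfolding filter_cong_iff[OF F] by blast
  have "b * f \<le> a"
    using tomonoid_mult_mono[OF assms(4) order_refl[of f]] f(2) by simp
  moreover have "a * f \<le> b"
    using mult_le_right[of a f] assms(3) by simp
  ultimately show ?thesis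
    using f(1) unfolding filter_cong_iff[OF F] by blast
qed

lemma class_eq_Image:
  fixes F :: "'a::qnc_tomonoid set"
  assumes F: "tomonoid_filter F" and "Q \<in> filter_classes F" "x \<in> Q"
  shows "Q = filter_cong F `` {x}"
  using assms quotientE[of Q UNIV] equiv_class_eq[OF equiv_filter_cong[OF F]]
  unfolding filter_classes_def by (metis Image_singleton_iff)

lemma mem_class_iff:
  fixes F :: "'a::qnc_tomonoid set"
  assumes F: "tomonoid_filter F" and "Q \<in> filter_classes F" "x \<in> Q"
  shows "y \<in> Q \<longleftrightarrow> (x, y) \<in> filter_cong F"
  using class_eq_Image[OF assms] by auto

lemma class_nonempty:
  fixes F :: "'a::qnc_tomonoid set"
  assumes F: "tomonoid_filter F" and "Q \<in> filter_classes F"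
  shows "Q \<noteq> {}"
  using assms in_quotient_imp_non_empty[OF equiv_filter_cong[OF F]]
  unfolding filter_classes_def by blast

lemma Image_in_classes: "filter_cong F `` {x} \<in> filter_classes F"
  unfolding filter_classes_def by (simp add: quotientI)

lemma mem_own_class:
  fixes F :: "'a::qnc_tomonoid set"
  assumes "tomonoid_filter F"
  shows "x \<in> filter_cong F `` {x}"
  by (rule equiv_class_self[OF equiv_filter_cong[OF assms]]) simp

lemma class_convex:
  fixes F :: "'a::qnc_tomonoid set"
  assumes F: "tomonoid_filter F" and Q: "Q \<in> filter_classes F"
    and "x \<in> Q" "z \<in> Q" "x \<le> y" "y \<le> z"
  shows "y \<in> Q"
  using filter_cong_convex[OF F] mem_class_iff[OF F Q] assms(3-) by blast

lemma filter_mult_in_class: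
  fixes F :: "'a::qnc_tomonoid set"
  assumes F: "tomonoid_filter F" and Q: "Q \<in> filter_classes F" and "x \<in> Q" "f \<in> F"
  shows "f * x \<in> Q"
proof -
  have "f * x * f \<le> x"
    using mult_le_right[of "f * x" f] mult_le_left[of f x] by (rule order_trans)
  then have "(x, f * x) \<in> filter_cong F"
    unfolding filter_cong_iff[OF F] using \<open>f \<in> F\<close> by (auto simp: mult.commute)
  then show ?thesis using mem_class_iff[OF F Q \<open>x \<in> Q\<close>] by blast
qed

lemma class_mult_eq:
  fixes F :: "'a::qnc_tomonoid set"
  assumes F: "tomonoid_filter F" and R: "R \<in> filter_classes F" and T: "T \<in> filter_classes F"
    and "x \<in> R" "t \<in> T"
  shows "class_mult F R T = filter_cong F `` {x * t}"
proof -
  have "filter_cong F `` {a * b} = filter_cong F `` {x * t}" if "a \<in> R" "b \<in> T" for a b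
  proof (rule equiv_class_eq[OF equiv_filter_cong[OF F]])
    show "(a * b, x * t) \<in> filter_cong F"
      using filter_cong_mult[OF F] mem_class_iff[OF F R that(1)] mem_class_iff[OF F T that(2)]
        assms(4,5) by blast
  qed
  then show ?thesis
    unfolding class_mult_def using assms(4,5) by blast
qed

lemma class_mult_in_classes:
  fixes F :: "'a::qnc_tomonoid set"
  assumes F: "tomonoid_filter F" and R: "R \<in> filter_classes F" and T: "T \<in> filter_classes F"
  shows "class_mult F R T \<in> filter_classes F"
proof -
  obtain x t where "x \<in> R" "t \<in> T" using class_nonempty[OF F] R T by blast
  from class_mult_eq[OF F R T this] show ?thesis by (simp add: Image_in_classes)
qed

text \<open>An upper bound of \<open>T\<close> whose class is not strictly above \<open>T\<close> belongs to \<open>T\<close>.\<close>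

lemma class_le_elem:
  fixes F :: "'a::qnc_tomonoid set"
  assumes F: "tomonoid_filter F" and T: "T \<in> filter_classes F"
    and le: "class_le (filter_cong F `` {u}) T" and ub: "\<forall>t\<in>T. t \<le> u"
  shows "u \<in> T"
proof -
  obtain a b where ab: "(u, a) \<in> filter_cong F" "b \<in> T" "a \<le> b"
    using le unfolding class_le_def by blast
  have sym: "(x, y) \<in> filter_cong F \<Longrightarrow> (y, x) \<in> filter_cong F" for x y
    using equivE[OF equiv_filter_cong[OF F]] by (meson symD)
  have "(a, b) \<in> filter_cong F"
    using filter_cong_convex[OF F sym[OF ab(1)] ab(3)] ub ab(2) by blast
  then have "(b, u) \<in> filter_cong F"
    using sym[OF ab(1)] sym equivE[OF equiv_filter_cong[OF F]] by (meson transD)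
  then show ?thesis using mem_class_iff[OF F T ab(2)] by blast
qed


section \<open>Linear coordinates\<close>

text \<open>
  The coordinate \<open>linear_coord k\<close> on the canonical chain of type \<open>k\<close> turns the action of the
  filter into a subtraction, cut off at the bottom element \<open>0\<close> where the chain has one;
  \<open>linear_chain k\<close> is its range and \<open>std_coord k\<close> its inverse.
\<close>

fun linear_coord :: "ctype \<Rightarrow> real \<Rightarrow> real" where
  "linear_coord Lukasiewicz r = r"
| "linear_coord Product r = ln r"
| "linear_coord ReversedProduct r = - ln (1 - r)"
| "linear_coord Power r = - ln (- ln r)"

fun std_coord :: "ctype \<Rightarrow> real \<Rightarrow> real" where
  "std_coord Lukasiewicz u = u"
| "std_coord Product u = exp u"
| "std_coord ReversedProduct u = 1 - exp (- u)"
| "std_coord Power u = exp (- exp (- u))"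

fun linear_chain :: "ctype \<Rightarrow> real set" where
  "linear_chain Lukasiewicz = {0..1}"
| "linear_chain Product = {..0}"
| "linear_chain ReversedProduct = {0..}"
| "linear_chain Power = UNIV"

text \<open>The cut-off at the bottom element; the identity for the types without bottom element.\<close>

fun cut_off :: "ctype \<Rightarrow> real \<Rightarrow> real" where
  "cut_off Lukasiewicz u = max u 0"
| "cut_off Product u = u"
| "cut_off ReversedProduct u = max u 0"
| "cut_off Power u = u"

lemma cut_off_chain: "u \<in> linear_chain k \<Longrightarrow> cut_off k u = u"
  by (cases k) auto

lemma std_coord_linear_coord: "r \<in> std_chain k \<Longrightarrow> std_coord k (linear_coord k r) = r"
  by (cases k) auto

lemma linear_coord_std_coord: "u \<in> linear_chain k \<Longrightarrow> linear_coord k (std_coord k u) = u"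
  by (cases k) auto

lemma linear_coord_in_chain: "r \<in> std_chain k \<Longrightarrow> linear_coord k r \<in> linear_chain k"
  by (cases k) auto

lemma std_coord_in_chain: "u \<in> linear_chain k \<Longrightarrow> std_coord k u \<in> std_chain k"
  by (cases k) auto

lemma linear_coord_le_iff:
  "r \<in> std_chain k \<Longrightarrow> r' \<in> std_chain k \<Longrightarrow> linear_coord k r \<le> linear_coord k r' \<longleftrightarrow> r \<le> r'"
  by (cases k) auto

lemma order_isomorphism_linear_coord:
  "order_isomorphism (linear_coord k) (std_chain k) (linear_chain k)"
  unfolding order_isomorphism_def
  using linear_coord_le_iff
  by (auto intro!: bij_betw_byWitness[where f' = "std_coord k"]
      simp: std_coord_linear_coord linear_coord_std_coord linear_coord_in_chain std_coord_in_chain)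

lemma order_isomorphism_comp:
  assumes "order_isomorphism \<phi> A B" "order_isomorphism \<psi> B C"
  shows "order_isomorphism (\<psi> \<circ> \<phi>) A C"
proof -
  have "\<phi> x \<in> B" if "x \<in> A" for x
    using assms(1) that unfolding order_isomorphism_def by (blast dest: bij_betwE)
  then show ?thesis
    using assms unfolding order_isomorphism_def by (auto intro: bij_betw_trans)
qed

lemma linear_coord_std_action:
  assumes "r \<in> std_chain k" "0 < f"
  shows "linear_coord k (std_action k \<alpha> f r) = cut_off k (linear_coord k r - \<alpha> * (- ln f))"
proof (cases k)
  case ReversedProduct
  then have r: "0 \<le> r" "r < 1" using assms by auto
  let ?q = "(1 - r) / f powr \<alpha>"
  have q: "?q > 0" using r assms(2) by simp
  have lnq: "ln ?q = ln (1 - r) - \<alpha> * ln f"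
    using r assms(2) by (simp add: ln_div ln_powr)
  have eq: "1 - max (1 - ?q) 0 = min ?q 1" by (simp add: min_def max_def)
  have "- ln (min ?q 1) = max (- ln ?q) 0"
    using q ln_le_zero_iff[of ?q] by (auto simp: min_def max_def)
  then have "- ln (1 - max (1 - ?q) 0) = max (- ln (1 - r) + \<alpha> * ln f) 0"
    unfolding eq lnq by simp
  then show ?thesis using ReversedProduct by simp
next
  case Power
  then have r: "0 < r" "r < 1" using assms by auto
  then have "0 < - ln r" by simp
  then have "ln (- ln r * (1 / f powr \<alpha>)) = ln (- ln r) - \<alpha> * ln f"
    using assms(2) by (subst ln_mult) (auto simp: ln_div ln_powr)
  moreover have "- ln (r powr (1 / f powr \<alpha>)) = - ln r * (1 / f powr \<alpha>)"
    using r by (simp add: ln_powr)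
  ultimately show ?thesis using Power by simp
qed (use assms in \<open>auto simp: ln_mult ln_powr\<close>)

text \<open>
  A linear chart of a class \<open>Q\<close>: \<open>g\<close> identifies \<open>Q\<close> with the linear chain of type \<open>k\<close> in such
  a way that \<open>f\<close> in the filter acts by subtracting \<open>\<alpha> * \<sigma> f\<close>, up to the cut-off.
\<close>

definition linear_chart ::
    "'a::tomonoid set \<Rightarrow> ('a \<Rightarrow> real) \<Rightarrow> ctype \<Rightarrow> 'a set \<Rightarrow> ('a \<Rightarrow> real) \<Rightarrow> real \<Rightarrow> bool" where
  "linear_chart F \<sigma> k Q g \<alpha> \<longleftrightarrow>
     order_isomorphism g Q (linear_chain k) \<and> \<alpha> > 0 \<and>
     (\<forall>f\<in>F. \<forall>x\<in>Q. g (f * x) = cut_off k (g x - \<alpha> * \<sigma> f))"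

lemma linear_chart_identified:
  fixes F :: "'a::qnc_tomonoid set"
  assumes F: "tomonoid_filter F" and \<iota>: "filter_identification F \<iota>"
    and Q: "Q \<in> filter_classes F" and ident: "identified F \<iota> k Q \<phi> \<alpha>"
  shows "linear_chart F (\<lambda>f. - ln (\<iota> f)) k Q (linear_coord k \<circ> \<phi>) \<alpha>"
  unfolding linear_chart_def
proof (intro conjI ballI)
  have iso: "order_isomorphism \<phi> Q (std_chain k)"
    using ident unfolding identified_def class_identification_def c_isomorphism_def by blast
  then show "order_isomorphism (linear_coord k \<circ> \<phi>) Q (linear_chain k)"
    using order_isomorphism_comp order_isomorphism_linear_coord by blast
  have coeff: "is_coefficient F \<iota> k Q \<phi> \<alpha>"
    using ident unfolding identified_def by blast
  then show "\<alpha> > 0" unfolding is_coefficient_def by blast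
  fix f x assume f: "f \<in> F" and x: "x \<in> Q"
  have bij: "bij_betw \<phi> Q (std_chain k)" using iso unfolding order_isomorphism_def by blast
  have \<phi>x: "\<phi> x \<in> std_chain k" using bij x by (blast dest: bij_betwE)
  have "\<phi> (f * x) = transport Q \<phi> (std_chain k) \<phi> (translation Q f) (\<phi> x)"
    using \<phi>x x bij_betw_inv_into_left[OF bij x] by (simp add: transport_def translation_def)
  also have "\<dots> = std_action k \<alpha> (\<iota> f) (\<phi> x)"
    using coeff f \<phi>x unfolding is_coefficient_def by simp
  finally have "\<phi> (f * x) = std_action k \<alpha> (\<iota> f) (\<phi> x)" .
  moreover have "\<iota> f > 0"
    using \<iota> f unfolding filter_identification_def order_isomorphism_def
    by (auto dest!: bij_betwE)
  ultimately show "(linear_coord k \<circ> \<phi>) (f * x)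
      = cut_off k ((linear_coord k \<circ> \<phi>) x - \<alpha> * (- ln (\<iota> f)))"
    using linear_coord_std_action[OF \<phi>x] by simp
qed

lemma filter_log_surj:
  assumes "filter_identification F \<iota>" "d \<ge> 0"
  shows "\<exists>f\<in>F. - ln (\<iota> f) = d"
proof -
  have "exp (- d) \<in> \<iota> ` F"
    using assms unfolding filter_identification_def order_isomorphism_def bij_betw_def by auto
  then show ?thesis by (metis imageE ln_exp minus_minus)
qed


section \<open>Translations in linear coordinates\<close>

text \<open>
  A maximal pair \<open>R\<close>, \<open>T\<close> with product \<open>S\<close>, together with linear charts \<open>g\<close> of \<open>R\<close> and \<open>h\<close> of \<open>S\<close>
  whose types are \<open>k\<close> and \<open>l\<close> and whose coefficients are \<open>\<alpha>\<close> and \<open>\<beta>\<close>; \<open>\<sigma>\<close> plays the role of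
  the negative logarithm on the filter.
\<close>

locale charted_pair =
  fixes F R T S :: "'a::qnc_tomonoid set" and \<sigma> :: "'a \<Rightarrow> real"
    and k l :: ctype and g h :: "'a \<Rightarrow> real" and \<alpha> \<beta> :: real
  assumes filter: "tomonoid_filter F"
    and R: "R \<in> filter_classes F" and T: "T \<in> filter_classes F"
    and maximal: "maximal_pair F R T"
    and S: "S = class_mult F R T"
    and log_surj: "d \<ge> 0 \<Longrightarrow> \<exists>f\<in>F. \<sigma> f = d"
    and chart_R: "linear_chart F \<sigma> k R g \<alpha>"
    and chart_S: "linear_chart F \<sigma> l S h \<beta>"
begin

text \<open>The slope \<open>\<kappa>\<close> of the translations in linear coordinates.\<close>

abbreviation "ratio \<equiv> \<beta> / \<alpha>"

lemma coeff_pos: "\<alpha> > 0" "\<beta> > 0"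
  using chart_R chart_S unfolding linear_chart_def by auto

lemma ratio_pos: "ratio > 0" using coeff_pos by simp

lemma T_nonempty: "T \<noteq> {}" by (rule class_nonempty[OF filter T])

lemma S_class: "S \<in> filter_classes F"
  unfolding S by (rule class_mult_in_classes[OF filter R T])

lemma mult_in_S: "t \<in> T \<Longrightarrow> x \<in> R \<Longrightarrow> t * x \<in> S"
  using class_mult_eq[OF filter R T] mem_own_class[OF filter] S by (metis mult.commute)

lemma g_le_iff: "x \<in> R \<Longrightarrow> y \<in> R \<Longrightarrow> g x \<le> g y \<longleftrightarrow> x \<le> y"
  using chart_R unfolding linear_chart_def order_isomorphism_def by simp

lemma h_le_iff: "x \<in> S \<Longrightarrow> y \<in> S \<Longrightarrow> h x \<le> h y \<longleftrightarrow> x \<le> y"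
  using chart_S unfolding linear_chart_def order_isomorphism_def by simp

lemma g_image: "g ` R = linear_chain k"
  using chart_R unfolding linear_chart_def order_isomorphism_def bij_betw_def by simp

lemma h_image: "h ` S = linear_chain l"
  using chart_S unfolding linear_chart_def order_isomorphism_def bij_betw_def by simp

lemma g_action: "f \<in> F \<Longrightarrow> x \<in> R \<Longrightarrow> g (f * x) = cut_off k (g x - \<alpha> * \<sigma> f)"
  using chart_R unfolding linear_chart_def by simp

lemma h_action: "f \<in> F \<Longrightarrow> x \<in> S \<Longrightarrow> h (f * x) = cut_off l (h x - \<beta> * \<sigma> f)"
  using chart_S unfolding linear_chart_def by simp

lemma g_inj: "x \<in> R \<Longrightarrow> y \<in> R \<Longrightarrow> g x = g y \<Longrightarrow> x = y"
  using g_le_iff by (metis order_antisym order_refl)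

lemma h_translation_in_chain: "t \<in> T \<Longrightarrow> x \<in> R \<Longrightarrow> h (t * x) \<in> linear_chain l"
  using mult_in_S h_image by blast

lemma obtain_shift:
  assumes "p \<in> R" "x \<in> R" "g x \<le> g p"
  obtains f where "f \<in> F" "\<alpha> * \<sigma> f = g p - g x" "f * p = x"
proof -
  obtain f where f: "f \<in> F" "\<sigma> f = (g p - g x) / \<alpha>"
    using log_surj[of "(g p - g x) / \<alpha>"] assms(3) coeff_pos by auto
  have *: "\<alpha> * \<sigma> f = g p - g x" using f(2) coeff_pos by simp
  have "g (f * p) = g x"
    unfolding g_action[OF f(1) assms(1)] * using assms(2) g_image cut_off_chain[of "g x" k] by auto
  then have "f * p = x"
    using g_inj filter_mult_in_class[OF filter R assms(1) f(1)] assms(2) by blast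
  then show ?thesis using that f(1) * by blast
qed

text \<open>
  A translation commutes with the action of the filter, so that its value at \<open>p\<close> determines its
  values below \<open>p\<close>.
\<close>

lemma translation_below:
  assumes "t \<in> T" "p \<in> R" "x \<in> R" "g x \<le> g p"
  shows "h (t * x) = cut_off l (h (t * p) - ratio * (g p - g x))"
proof -
  obtain f where f: "f \<in> F" "\<alpha> * \<sigma> f = g p - g x" "f * p = x"
    using obtain_shift[OF assms(2-)] .
  have "t * x = f * (t * p)" unfolding f(3)[symmetric] by (rule mult.left_commute)
  then have "h (t * x) = cut_off l (h (t * p) - \<beta> * \<sigma> f)"
    using h_action[OF f(1) mult_in_S[OF assms(1,2)]] by simp
  moreover have "ratio * (g p - g x) = \<beta> * \<sigma> f"
    unfolding f(2)[symmetric] using coeff_pos by simp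
  ultimately show ?thesis by simp
qed

text \<open>
  A bottom element of \<open>R\<close> is fixed by the whole filter, hence so is its image, which is
  therefore the bottom element of \<open>S\<close>.
\<close>

lemma translation_bottom:
  assumes "t \<in> T" "x \<in> R" "g x = 0" "k = Lukasiewicz \<or> k = ReversedProduct"
    and l: "l = Lukasiewicz \<or> l = ReversedProduct"
  shows "h (t * x) = 0"
proof -
  have nn: "h (t * x) \<ge> 0" using h_translation_in_chain[OF assms(1,2)] l by auto
  obtain f where f: "f \<in> F" "\<sigma> f = h (t * x) / \<beta>"
    using log_surj[of "h (t * x) / \<beta>"] nn coeff_pos by auto
  have "g (f * x) = g x"
    unfolding g_action[OF f(1) assms(2)] using assms(3,4) f(2) nn coeff_pos by auto
  then have "f * x = x"
    using g_inj filter_mult_in_class[OF filter R assms(2) f(1)] assms(2) by blast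
  then have "h (t * x) = h (t * (f * x))" by simp
  also have "\<dots> = h (f * (t * x))" by (simp add: mult.left_commute)
  also have "\<dots> = 0"
    unfolding h_action[OF f(1) mult_in_S[OF assms(1,2)]] using f(2) l coeff_pos by auto
  finally show ?thesis .
qed

text \<open>
  The values at \<open>p\<close> of all translations by elements of \<open>T\<close> form a principal down-set of the
  linear chain or the whole chain: if \<open>T\<close> had no largest element and these values were bounded
  in \<open>S\<close>, then the supremum of \<open>T\<close>, which lies above \<open>T\<close>, would still map \<open>p\<close> into \<open>S\<close>,
  contradicting maximality of \<open>T\<close>.
\<close>

lemma values_at_point:
  assumes p: "p \<in> R"
  defines "Z \<equiv> (\<lambda>t. h (t * p)) ` T"
  shows "Z = linear_chain l \<or> (\<exists>m\<in>linear_chain l. Z = {z \<in> linear_chain l. z \<le> m})"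
proof -
  have sub: "Z \<subseteq> linear_chain l" using h_translation_in_chain p unfolding Z_def by blast
  have down: "z' \<in> Z" if "z \<in> Z" and z': "z' \<in> linear_chain l" "z' \<le> z" for z z'
  proof -
    obtain t where t: "t \<in> T" "z = h (t * p)" using \<open>z \<in> Z\<close> unfolding Z_def by blast
    obtain f where f: "f \<in> F" "\<sigma> f = (z - z') / \<beta>"
      using log_surj[of "(z - z') / \<beta>"] divide_nonneg_pos[of "z - z'" \<beta>] z'(2) coeff_pos by auto
    have "h (f * (t * p)) = cut_off l z'"
      unfolding h_action[OF f(1) mult_in_S[OF t(1) p]] using f(2) t(2) coeff_pos by simp
    then have "h ((f * t) * p) = z'" using z'(1) by (simp add: mult.assoc cut_off_chain)
    then show ?thesis
      using filter_mult_in_class[OF filter T t(1) f(1)] unfolding Z_def by blast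
  qed
  obtain u where u: "is_supremum T u" using ex_supremum[OF T_nonempty] by blast
  then have ub: "\<forall>t\<in>T. t \<le> u" unfolding is_supremum_def by blast
  show ?thesis
  proof (cases "u \<in> T")
    case True
    have "z \<le> h (u * p)" if "z \<in> Z" for z
    proof -
      obtain t where t: "t \<in> T" "z = h (t * p)" using \<open>z \<in> Z\<close> unfolding Z_def by blast
      have "t * p \<le> u * p" using ub t(1) by (simp add: tomonoid_mult_mono)
      then show ?thesis using h_le_iff mult_in_S p t True by simp
    qed
    moreover have "h (u * p) \<in> Z" using True unfolding Z_def by blast
    ultimately have "Z = {z \<in> linear_chain l. z \<le> h (u * p)}" using sub down by blast
    then show ?thesis using \<open>h (u * p) \<in> Z\<close> sub by blast
  next
    case False
    have notS: "u * p \<notin> S"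
    proof
      let ?U = "filter_cong F `` {u}"
      assume "u * p \<in> S"
      then have "S = filter_cong F `` {p * u}"
        using class_eq_Image[OF filter S_class] by (simp add: mult.commute)
      also have "\<dots> = class_mult F R ?U"
        using class_mult_eq[OF filter R Image_in_classes p mem_own_class[OF filter]] by simp
      finally have "class_le ?U T"
        using maximal Image_in_classes unfolding S maximal_pair_def by metis
      then show False using class_le_elem[OF filter T _ ub] False by blast
    qed
    have sup: "is_supremum ((\<lambda>t. t * p) ` T) (u * p)"
      by (rule mult_supremum_right[OF T_nonempty u])
    have "z \<in> Z" if "z \<in> linear_chain l" for z
    proof -
      obtain s where s: "s \<in> S" "z = h s" using \<open>z \<in> linear_chain l\<close> h_image by blast
      obtain t0 where t0: "t0 \<in> T" using T_nonempty by blast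
      have "\<not> (\<forall>t\<in>T. t * p \<le> s)"
      proof
        assume "\<forall>t\<in>T. t * p \<le> s"
        then have "u * p \<le> s" using sup unfolding is_supremum_def by blast
        moreover have "t0 * p \<le> u * p" using ub t0 by (simp add: tomonoid_mult_mono)
        ultimately show False
          using class_convex[OF filter S_class mult_in_S[OF t0 p] s(1)] notS by blast
      qed
      then obtain t where t: "t \<in> T" "s \<le> t * p" by (meson linear)
      then have "z \<le> h (t * p)" using s h_le_iff mult_in_S p by simp
      then show ?thesis using down that t(1) unfolding Z_def by blast
    qed
    then show ?thesis using sub by blast
  qed
qed

lemma translation_no_bottom:
  assumes "t \<in> T" "p \<in> R" "x \<in> R" and l: "cut_off l = (\<lambda>u. u)"
  shows "h (t * x) = ratio * (g x - g p) + h (t * p)"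
proof (cases "g x \<le> g p")
  case True
  then show ?thesis
    using translation_below[OF assms(1-3)] l by (simp add: algebra_simps)
next
  case False
  then show ?thesis
    using translation_below[OF assms(1,3,2)] l by (simp add: algebra_simps)
qed

text \<open>
  If \<open>R\<close> has no top element and \<open>S\<close> has a bottom element, then either all translations are
  constant or none is: every element of \<open>T\<close> is at least a multiple by the filter of any other one,
  and the loss is compensated by moving upwards in \<open>R\<close>.
\<close>

lemma translation_topless:
  assumes k: "k = ReversedProduct \<or> k = Power"
    and l: "l = Lukasiewicz \<or> l = ReversedProduct"
  shows "trivial_translations T R S \<or>
    (\<forall>t\<in>T. \<exists>c. \<forall>x\<in>R. h (t * x) = max (ratio * g x + c) 0)"
proof (cases "\<forall>t\<in>T. \<forall>x\<in>R. h (t * x) = 0")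
  case True
  have "0 \<in> linear_chain l" using l by auto
  then obtain p where p: "p \<in> S" "h p = 0" using h_image by (metis imageE)
  have bot: "\<forall>s\<in>S. p \<le> s"
  proof
    fix s assume "s \<in> S"
    then have "h s \<in> linear_chain l" using h_image by blast
    then have "h p \<le> h s" using p(2) l by auto
    then show "p \<le> s" using h_le_iff p(1) \<open>s \<in> S\<close> by blast
  qed
  have "t * x = p" if "t \<in> T" "x \<in> R" for t x
  proof -
    have "h (t * x) = h p" using True that p(2) by simp
    then show ?thesis using h_le_iff mult_in_S[OF that] p(1) by (metis order_antisym order_refl)
  qed
  then have "translation R t = (\<lambda>x\<in>R. p)" if "t \<in> T" for t
    using that unfolding translation_def by (auto intro: restrict_ext)
  then have "Lambda_maps T R = {\<lambda>x\<in>R. p}"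
    unfolding Lambda_maps_def using T_nonempty by auto
  then have "trivial_translations T R S"
    unfolding trivial_translations_def using p(1) bot by blast
  then show ?thesis ..
next
  case False
  then obtain t0 x0 where t0: "t0 \<in> T" "x0 \<in> R" "h (t0 * x0) \<noteq> 0" by blast
  then have pos0: "h (t0 * x0) > 0" using h_translation_in_chain[OF t0(1,2)] l by auto
  have "\<exists>c. \<forall>x\<in>R. h (t * x) = max (ratio * g x + c) 0" if t: "t \<in> T" for t
  proof -
    obtain f where f: "f \<in> F" "t0 * f \<le> t"
      using mem_class_iff[OF filter T t0(1)] t unfolding filter_cong_iff[OF filter] by blast
    \<comment> \<open>\<open>x1\<close> lies so high that \<open>x0 \<le> f * x1\<close>, and then \<open>t0 * x0 \<le> t0 * f * x1 \<le> t * x1\<close>.\<close>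
    have "g x0 + \<alpha> * \<bar>\<sigma> f\<bar> \<in> linear_chain k"
    proof -
      have "g x0 \<in> linear_chain k" using t0(2) g_image by blast
      then show ?thesis using k coeff_pos by auto
    qed
    then obtain x1 where x1: "x1 \<in> R" "g x1 = g x0 + \<alpha> * \<bar>\<sigma> f\<bar>" using g_image by (metis imageE)
    have gfx: "g x0 \<le> g (f * x1)"
    proof -
      have "g (f * x1) = cut_off k (g x1 - \<alpha> * \<sigma> f)" by (rule g_action[OF f(1) x1(1)])
      moreover have "\<alpha> * \<sigma> f \<le> \<alpha> * \<bar>\<sigma> f\<bar>" using coeff_pos by simp
      ultimately show ?thesis using x1(2) k by auto
    qed
    have fx: "f * x1 \<in> R" by (rule filter_mult_in_class[OF filter R x1(1) f(1)])
    then have "x0 \<le> f * x1" using gfx g_le_iff t0(2) by blast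
    then have "t0 * x0 \<le> t0 * (f * x1)" by (simp add: tomonoid_mult_mono)
    also have "\<dots> \<le> t * x1" using tomonoid_mult_mono[OF f(2) order_refl[of x1]] by (simp add: mult.assoc)
    finally have "h (t0 * x0) \<le> h (t * x1)" using h_le_iff mult_in_S t0 t x1(1) by simp
    then have pos: "h (t * x1) > 0" using pos0 by simp
    have cut: "cut_off l = (\<lambda>u. max u 0)" using l by auto
    have "h (t * x) = max (ratio * g x + (h (t * x1) - ratio * g x1)) 0" if x: "x \<in> R" for x
    proof (cases "g x \<le> g x1")
      case True
      then show ?thesis
        using translation_below[OF t x1(1) x True] cut by (simp add: algebra_simps)
    next
      case False
      have "h (t * x1) = max (h (t * x) - ratio * (g x - g x1)) 0"
        using translation_below[OF t x x1(1)] False cut by simp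
      moreover have "ratio * (g x - g x1) > 0" using ratio_pos False by (intro mult_pos_pos) auto
      ultimately show ?thesis using pos by (simp add: max_def algebra_simps split: if_splits)
    qed
    then show ?thesis by blast
  qed
  then show ?thesis by blast
qed

end

section \<open>Families of translations in canonical coordinates\<close>

lemma real_translations_eq:
  assumes \<phi>: "order_isomorphism \<phi> R (std_chain k)"
    and \<psi>: "order_isomorphism \<psi> S (std_chain l)"
    and in_S: "\<And>t x. t \<in> T \<Longrightarrow> x \<in> R \<Longrightarrow> t * x \<in> S"
    and G: "\<And>t x. t \<in> T \<Longrightarrow> x \<in> R \<Longrightarrow>
      linear_coord l (\<psi> (t * x)) = G (w t) (linear_coord k (\<phi> x))"
  shows "real_translations k T R \<phi> \<psi> =
    (\<lambda>z. \<lambda>r\<in>std_chain k. std_coord l (G z (linear_coord k r))) ` w ` T"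
proof -
  have bij: "bij_betw \<phi> R (std_chain k)" using \<phi> unfolding order_isomorphism_def by blast
  have "transport R \<phi> (std_chain k) \<psi> (translation R t) =
      (\<lambda>r\<in>std_chain k. std_coord l (G (w t) (linear_coord k r)))" if t: "t \<in> T" for t
    unfolding transport_def
  proof (rule restrict_ext)
    fix r assume r: "r \<in> std_chain k"
    define x where "x = inv_into R \<phi> r"
    have x: "x \<in> R" "\<phi> x = r"
      using r bij bij_betw_inv_into_right[OF bij] unfolding x_def
      by (auto intro: bij_betwE[OF bij_betw_inv_into, rule_format])
    have "\<psi> (t * x) \<in> std_chain l"
      using \<psi> in_S[OF t x(1)] unfolding order_isomorphism_def by (blast dest: bij_betwE)
    then have "\<psi> (t * x) = std_coord l (linear_coord l (\<psi> (t * x)))"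
      by (simp add: std_coord_linear_coord)
    then show "\<psi> (translation R t (inv_into R \<phi> r)) = std_coord l (G (w t) (linear_coord k r))"
      unfolding x_def[symmetric] using G[OF t x(1)] x by (simp add: translation_def)
  qed
  then show ?thesis
    unfolding real_translations_def Lambda_maps_def image_image by (rule image_cong[OF refl])
qed

text \<open>
  The maps that have slope \<open>\<kappa>\<close> in linear coordinates, up to the cut-off, and take a value from
  \<open>Z\<close> at the point with coordinate \<open>p\<close>.
\<close>

definition affine_maps :: "ctype \<Rightarrow> ctype \<Rightarrow> real \<Rightarrow> real \<Rightarrow> real set \<Rightarrow> (real \<Rightarrow> real) set" where
  "affine_maps k l \<kappa> p Z =
     (\<lambda>z. \<lambda>r\<in>std_chain k. std_coord l (cut_off l (z - \<kappa> * (p - linear_coord k r)))) ` Z"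

text \<open>
  A maximal pair \<open>R\<close>, \<open>T\<close> whose classes \<open>R\<close> and \<open>S\<close> (the product of \<open>R\<close> and \<open>T\<close>) are identified
  with the canonical chains of types \<open>k\<close> and \<open>l\<close>.
\<close>

locale identified_pair =
  fixes F R T S :: "'a::qnc_tomonoid set" and \<iota> :: "'a \<Rightarrow> real"
    and k l :: ctype and \<phi> \<psi> :: "'a \<Rightarrow> real" and \<alpha> \<beta> :: real
  assumes filter: "tomonoid_filter F" and \<iota>: "filter_identification F \<iota>"
    and R: "R \<in> filter_classes F" and T: "T \<in> filter_classes F"
    and maximal: "maximal_pair F R T"
    and S: "S = class_mult F R T"
    and ident_R: "identified F \<iota> k R \<phi> \<alpha>" and ident_S: "identified F \<iota> l S \<psi> \<beta>"

sublocale identified_pair \<subseteq>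
  charted_pair F R T S "\<lambda>f. - ln (\<iota> f)" k l "linear_coord k \<circ> \<phi>" "linear_coord l \<circ> \<psi>" \<alpha> \<beta>
proof unfold_locales
  show "linear_chart F (\<lambda>f. - ln (\<iota> f)) k R (linear_coord k \<circ> \<phi>) \<alpha>"
    by (rule linear_chart_identified[OF filter \<iota> R ident_R])
  have "S \<in> filter_classes F" unfolding S by (rule class_mult_in_classes[OF filter R T])
  then show "linear_chart F (\<lambda>f. - ln (\<iota> f)) l S (linear_coord l \<circ> \<psi>) \<beta>"
    by (rule linear_chart_identified[OF filter \<iota> _ ident_S])
qed (use filter R T maximal S filter_log_surj[OF \<iota>] in auto)

context identified_pair
begin

lemma order_isomorphism_R: "order_isomorphism \<phi> R (std_chain k)"
  using ident_R unfolding identified_def class_identification_def c_isomorphism_def by blast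

lemma order_isomorphism_S: "order_isomorphism \<psi> S (std_chain l)"
  using ident_S unfolding identified_def class_identification_def c_isomorphism_def by blast

text \<open>
  If \<open>p\<close> is the top element of \<open>R\<close>, or if no cut-off takes place in \<open>S\<close>, then all translations
  are determined by their values at \<open>p\<close>. A bottom element of \<open>R\<close> bounds these values, since it
  has to be mapped to the bottom element of \<open>S\<close>.
\<close>

lemma real_translations_affine:
  assumes p: "p \<in> linear_chain k"
    and top: "(\<forall>u\<in>linear_chain k. u \<le> p) \<or> cut_off l = (\<lambda>u. u)"
  obtains Z where "real_translations k T R \<phi> \<psi> = affine_maps k l ratio p Z"
    and "Z = linear_chain l \<or> (\<exists>m\<in>linear_chain l. Z = {z \<in> linear_chain l. z \<le> m})"
    and "k = Lukasiewicz \<Longrightarrow> l = Lukasiewicz \<or> l = ReversedProduct \<Longrightarrow> \<forall>z\<in>Z. z \<le> ratio * p"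
proof -
  obtain x0 where x0: "x0 \<in> R" "linear_coord k (\<phi> x0) = p"
    using p g_image by (metis comp_apply imageE)
  let ?Z = "(\<lambda>t. (linear_coord l \<circ> \<psi>) (t * x0)) ` T"
  have below: "linear_coord k (\<phi> x) \<le> p \<or> cut_off l = (\<lambda>u. u)" if "x \<in> R" for x
    using that top g_image by auto
  have form: "linear_coord l (\<psi> (t * x)) =
      cut_off l (linear_coord l (\<psi> (t * x0)) - ratio * (p - linear_coord k (\<phi> x)))"
    if "t \<in> T" "x \<in> R" for t x
    using below[OF that(2)]
  proof
    assume "linear_coord k (\<phi> x) \<le> p"
    then show ?thesis using translation_below[OF that(1) x0(1) that(2)] x0(2) by simp
  next
    assume l: "cut_off l = (\<lambda>u. u)"
    then show ?thesis
      using translation_no_bottom[OF that(1) x0(1) that(2) l] x0(2) by (simp add: algebra_simps)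
  qed
  have "real_translations k T R \<phi> \<psi> = affine_maps k l ratio p ?Z"
    unfolding affine_maps_def comp_apply
    by (rule real_translations_eq[OF order_isomorphism_R order_isomorphism_S mult_in_S])
      (simp_all add: form)
  moreover have "?Z = linear_chain l \<or> (\<exists>m\<in>linear_chain l. ?Z = {z \<in> linear_chain l. z \<le> m})"
    by (rule values_at_point[OF x0(1)])
  moreover have "\<forall>z\<in>?Z. z \<le> ratio * p"
    if k: "k = Lukasiewicz" and l: "l = Lukasiewicz \<or> l = ReversedProduct"
  proof (rule ballI, erule imageE)
    fix z t assume z: "z = (linear_coord l \<circ> \<psi>) (t * x0)" and t: "t \<in> T"
    obtain x where x: "x \<in> R" "(linear_coord k \<circ> \<phi>) x = 0"
      using g_image k by (metis atLeastAtMost_iff imageE linear_chain.simps(1) order_refl zero_le_one)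
    have "linear_coord l (\<psi> (t * x)) = 0"
      using translation_bottom[OF t x _ l] k by simp
    then show "z \<le> ratio * p" using form[OF t x(1)] x(2) l z by auto
  qed
  ultimately show ?thesis by (rule that)
qed

text \<open>
  In linear coordinates the non-constant translations are \<open>u \<mapsto> max (ratio * u + c) 0\<close>. A bottom
  element of \<open>R\<close> has coordinate \<open>0\<close> and is mapped to \<open>0\<close>, whence \<open>c \<le> 0\<close>.
\<close>

lemma real_translations_topless:
  assumes k: "k = ReversedProduct \<or> k = Power" and l: "l = ReversedProduct"
  shows "trivial_translations T R S \<or>
    (\<exists>C. real_translations k T R \<phi> \<psi> =
        (\<lambda>c. \<lambda>r\<in>std_chain k. 1 - exp (- max (ratio * linear_coord k r + c) 0)) ` C \<and>
      (k = ReversedProduct \<longrightarrow> (\<forall>c\<in>C. c \<le> 0)))"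
proof (rule disjCI)
  assume "\<not> (\<exists>C. real_translations k T R \<phi> \<psi> =
        (\<lambda>c. \<lambda>r\<in>std_chain k. 1 - exp (- max (ratio * linear_coord k r + c) 0)) ` C \<and>
      (k = ReversedProduct \<longrightarrow> (\<forall>c\<in>C. c \<le> 0)))" (is "\<not> ?form")
  show "trivial_translations T R S"
  proof (rule ccontr)
    assume "\<not> trivial_translations T R S"
    then have "\<forall>t\<in>T. \<exists>c. \<forall>x\<in>R.
        linear_coord l (\<psi> (t * x)) = max (ratio * linear_coord k (\<phi> x) + c) 0"
      using translation_topless[OF k] l by auto
    then obtain w where w: "\<And>t x. t \<in> T \<Longrightarrow> x \<in> R \<Longrightarrow>
        linear_coord l (\<psi> (t * x)) = max (ratio * linear_coord k (\<phi> x) + w t) 0"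
      by metis
    have "real_translations k T R \<phi> \<psi> =
        (\<lambda>c. \<lambda>r\<in>std_chain k. std_coord l (max (ratio * linear_coord k r + c) 0)) ` w ` T"
      by (rule real_translations_eq[OF order_isomorphism_R order_isomorphism_S mult_in_S,
            where G = "\<lambda>c u. max (ratio * u + c) 0"]) (simp_all add: w)
    moreover have "w t \<le> 0" if t: "t \<in> T" and k: "k = ReversedProduct" for t
    proof -
      obtain x where x: "x \<in> R" "(linear_coord k \<circ> \<phi>) x = 0"
        using g_image k by (metis atLeast_iff imageE linear_chain.simps(3) order_refl)
      then have "linear_coord l (\<psi> (t * x)) = 0"
        using translation_bottom[OF t x] k l by simp
      then show ?thesis using w[OF t x(1)] x(2) by simp
    qed
    ultimately have ?form using l by auto
    then show False using \<open>\<not> ?form\<close> by blast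
  qed
qed

end


section \<open>Conversion to the canonical chains\<close>

lemma restrict_image_reparametrize:
  assumes "\<And>z. z \<in> Z \<Longrightarrow> P (q z)" "\<And>w. P w \<Longrightarrow> \<exists>z\<in>Z. q z = w"
    and "\<And>z r. z \<in> Z \<Longrightarrow> r \<in> A \<Longrightarrow> H z r = H' (q z) r"
  shows "(\<lambda>z. restrict (H z) A) ` Z = {restrict (H' w) A | w. P w}"
proof -
  have "restrict (H z) A = restrict (H' (q z)) A" if "z \<in> Z" for z
    using assms(3)[OF that] by (rule restrict_ext)
  then show ?thesis using assms(1,2) by (auto simp: image_iff) metis+
qed

lemma one_minus_exp_max: "1 - exp (- max x 0) = max (1 - exp (- x)) (0::real)"
  by (auto simp: max_def)

lemma principal_down_set_unit:
  assumes "Z = {0..1} \<or> (\<exists>m\<in>{0..1}. Z = {z \<in> {0..1}. z \<le> m})"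
  shows "\<exists>m\<in>{0..1}. Z = {0..m::real}"
  using assms
proof
  assume "\<exists>m\<in>{0..1}. Z = {z \<in> {0..1}. z \<le> m}"
  then obtain m where "m \<in> {0..1}" "Z = {z \<in> {0..1}. z \<le> m}" by blast
  then have "Z = {0..m}" by auto
  then show ?thesis using \<open>m \<in> {0..1}\<close> by blast
qed (intro bexI[of _ 1], auto)

lemma affine_Lukasiewicz_Lukasiewicz:
  "affine_maps Lukasiewicz Lukasiewicz \<kappa> 1 {0..m} =
     {(\<lambda>r\<in>{0..1}. max (\<kappa> * r + z) 0) | z. -\<kappa> \<le> z \<and> z \<le> m - \<kappa>}"
  unfolding affine_maps_def std_chain.simps
proof (rule restrict_image_reparametrize[where q = "\<lambda>z. z - \<kappa>"])
  show "\<exists>z\<in>{0..m}. z - \<kappa> = w" if "-\<kappa> \<le> w \<and> w \<le> m - \<kappa>" for w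
    using that by (intro bexI[of _ "w + \<kappa>"]) auto
qed (auto simp: algebra_simps)

lemma affine_Lukasiewicz_ReversedProduct:
  assumes "\<kappa> > 0"
  shows "affine_maps Lukasiewicz ReversedProduct \<kappa> 1 {0..m} =
     {(\<lambda>r\<in>{0..1}. max (1 - exp (-\<kappa> * (r + z))) 0) | z. -1 \<le> z \<and> z \<le> m / \<kappa> - 1}"
  unfolding affine_maps_def std_chain.simps
proof (rule restrict_image_reparametrize[where q = "\<lambda>z. z / \<kappa> - 1"])
  show "-1 \<le> z / \<kappa> - 1 \<and> z / \<kappa> - 1 \<le> m / \<kappa> - 1" if "z \<in> {0..m}" for z
    using that assms by (simp add: divide_right_mono)
  show "\<exists>z\<in>{0..m}. z / \<kappa> - 1 = w" if "-1 \<le> w \<and> w \<le> m / \<kappa> - 1" for w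
  proof (intro bexI[of _ "\<kappa> * (w + 1)"])
    have "0 \<le> \<kappa> * (w + 1)" using that assms by simp
    then show "\<kappa> * (w + 1) \<in> {0..m}" using that assms by (simp add: field_simps)
  qed (use assms in simp)
  show "std_coord ReversedProduct (cut_off ReversedProduct
      (z - \<kappa> * (1 - linear_coord Lukasiewicz r))) = max (1 - exp (-\<kappa> * (r + (z / \<kappa> - 1)))) 0" for z r
  proof -
    have "- (z - \<kappa> * (1 - r)) = -\<kappa> * (r + (z / \<kappa> - 1))" using assms by (simp add: field_simps)
    then show ?thesis by (simp only: std_coord.simps cut_off.simps linear_coord.simps one_minus_exp_max)
  qed
qed

lemma affine_Product_Lukasiewicz:
  "affine_maps Product Lukasiewicz \<kappa> 0 {0..m} =
     {(\<lambda>r\<in>{0<..1}. max (\<kappa> * ln r + z) 0) | z. 0 \<le> z \<and> z \<le> m}"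
  unfolding affine_maps_def std_chain.simps
  by (rule restrict_image_reparametrize[where q = "\<lambda>z. z"]) (auto simp: algebra_simps)

lemma affine_Product_Product:
  "affine_maps Product Product \<kappa> 0 {..m} =
     {(\<lambda>r\<in>{0<..1}. z * r powr \<kappa>) | z. 0 < z \<and> z \<le> exp m}"
  unfolding affine_maps_def std_chain.simps
proof (rule restrict_image_reparametrize[where q = exp])
  show "\<exists>z\<in>{..m}. exp z = w" if "0 < w \<and> w \<le> exp m" for w
    using that ln_le_cancel_iff[of w "exp m"] by (intro bexI[of _ "ln w"]) auto
qed (auto simp: powr_def exp_add)

lemma product_reversed_product_coord:
  assumes "r \<in> {0<..1}"
  shows "std_coord ReversedProduct (cut_off ReversedProduct
      (z - \<kappa> * (0 - linear_coord Product r))) = max (1 - 1 / (exp z * r powr \<kappa>)) 0"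
proof -
  have "exp (- (z - \<kappa> * (0 - ln r))) = 1 / (exp z * r powr \<kappa>)"
    using assms by (simp add: powr_def exp_add exp_diff exp_minus field_simps)
  then show ?thesis
    by (simp only: std_coord.simps cut_off.simps linear_coord.simps one_minus_exp_max)
qed

lemma affine_Product_ReversedProduct:
  "affine_maps Product ReversedProduct \<kappa> 0 {0..} =
     {(\<lambda>r\<in>{0<..1}. max (1 - 1 / (z * r powr \<kappa>)) 0) | z. 1 \<le> z}"
  "affine_maps Product ReversedProduct \<kappa> 0 {0..m} =
     {(\<lambda>r\<in>{0<..1}. max (1 - 1 / (z * r powr \<kappa>)) 0) | z. 1 \<le> z \<and> z \<le> exp m}"
proof -
  have 1: "\<exists>z\<in>{0..}. exp z = w" if "1 \<le> w" for w :: real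
    using that by (intro bexI[of _ "ln w"]) auto
  have 2: "\<exists>z\<in>{0..m}. exp z = w" if "1 \<le> w \<and> w \<le> exp m" for w :: real
    using that ln_le_cancel_iff[of w "exp m"] by (intro bexI[of _ "ln w"]) auto
  show "affine_maps Product ReversedProduct \<kappa> 0 {0..} =
     {(\<lambda>r\<in>{0<..1}. max (1 - 1 / (z * r powr \<kappa>)) 0) | z. 1 \<le> z}"
    unfolding affine_maps_def std_chain.simps
    by (rule restrict_image_reparametrize[where q = exp], simp, erule 1,
        erule product_reversed_product_coord)
  show "affine_maps Product ReversedProduct \<kappa> 0 {0..m} =
     {(\<lambda>r\<in>{0<..1}. max (1 - 1 / (z * r powr \<kappa>)) 0) | z. 1 \<le> z \<and> z \<le> exp m}"
    unfolding affine_maps_def std_chain.simps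
    by (rule restrict_image_reparametrize[where q = exp], simp, erule 2,
        erule product_reversed_product_coord)
qed

lemma double_exp_le_iff: "exp (- exp (- x)) \<le> exp (- exp (- y)) \<longleftrightarrow> x \<le> (y::real)"
  by simp

lemma double_exp_surj: "0 < w \<Longrightarrow> w < 1 \<Longrightarrow> \<exists>z. exp (- exp (- z)) = (w::real)"
  by (intro exI[of _ "- ln (- ln w)"]) simp

text \<open>
  Covers the maps from a chain of product type, where \<open>\<rho> r\<close> is \<open>r powr (-\<kappa>)\<close>, as well as
  those from a chain of power type, where \<open>\<rho> r\<close> is \<open>(- ln r) powr \<kappa>\<close>.
\<close>

lemma affine_to_Power:
  assumes "\<And>r. r \<in> std_chain k \<Longrightarrow> \<rho> r = exp (- \<kappa> * linear_coord k r)"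
  shows "affine_maps k Power \<kappa> 0 UNIV =
      {(\<lambda>r\<in>std_chain k. z powr \<rho> r) | z. 0 < z \<and> z < 1}"
    and "affine_maps k Power \<kappa> 0 {..m} =
      {(\<lambda>r\<in>std_chain k. z powr \<rho> r) | z. 0 < z \<and> z \<le> exp (- exp (- m))}"
proof -
  have coord: "std_coord Power (cut_off Power (z - \<kappa> * (0 - linear_coord k r))) =
      exp (- exp (- z)) powr \<rho> r" if "r \<in> std_chain k" for z r
  proof -
    have "exp (- (z - \<kappa> * (0 - linear_coord k r))) = exp (- z) * \<rho> r"
      unfolding assms[OF that] exp_add[symmetric] by simp
    then show ?thesis by (simp add: powr_def mult.commute)
  qed
  show "affine_maps k Power \<kappa> 0 UNIV = {(\<lambda>r\<in>std_chain k. z powr \<rho> r) | z. 0 < z \<and> z < 1}"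
    unfolding affine_maps_def
    by (rule restrict_image_reparametrize[where q = "\<lambda>z. exp (- exp (- z))"])
      (use double_exp_surj coord in auto)
  show "affine_maps k Power \<kappa> 0 {..m} =
      {(\<lambda>r\<in>std_chain k. z powr \<rho> r) | z. 0 < z \<and> z \<le> exp (- exp (- m))}"
    unfolding affine_maps_def
  proof (rule restrict_image_reparametrize[where q = "\<lambda>z. exp (- exp (- z))"])
    fix w assume w: "0 < w \<and> w \<le> exp (- exp (- m))"
    have "exp (- exp (- m)) < 1" by simp
    then obtain z where "exp (- exp (- z)) = w" using double_exp_surj[of w] w by fastforce
    then show "\<exists>z\<in>{..m}. exp (- exp (- z)) = w" using w double_exp_le_iff by auto
  qed (use coord in auto)
qed

lemma affine_Product_Power:
  "affine_maps Product Power \<kappa> 0 UNIV =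
     {(\<lambda>r\<in>{0<..1}. z powr (r powr (-\<kappa>))) | z. 0 < z \<and> z < 1}"
  "affine_maps Product Power \<kappa> 0 {..m} =
     {(\<lambda>r\<in>{0<..1}. z powr (r powr (-\<kappa>))) | z. 0 < z \<and> z \<le> exp (- exp (- m))}"
proof -
  have "r powr (-\<kappa>) = exp (- \<kappa> * linear_coord Product r)" if "r \<in> std_chain Product" for r
    using that by (simp add: powr_def)
  note forms = affine_to_Power[where k = Product and \<kappa> = \<kappa> and \<rho> = "\<lambda>r. r powr (-\<kappa>)", OF this]
  show "affine_maps Product Power \<kappa> 0 UNIV =
     {(\<lambda>r\<in>{0<..1}. z powr (r powr (-\<kappa>))) | z. 0 < z \<and> z < 1}"
    using forms(1) by (simp only: std_chain.simps)
  show "affine_maps Product Power \<kappa> 0 {..m} =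
     {(\<lambda>r\<in>{0<..1}. z powr (r powr (-\<kappa>))) | z. 0 < z \<and> z \<le> exp (- exp (- m))}"
    using forms(2) by (simp only: std_chain.simps)
qed

lemma affine_Power_Power:
  "affine_maps Power Power \<kappa> 0 UNIV =
     {(\<lambda>r\<in>{0<..<1}. z powr ((- ln r) powr \<kappa>)) | z. 0 < z \<and> z < 1}"
  "affine_maps Power Power \<kappa> 0 {..m} =
     {(\<lambda>r\<in>{0<..<1}. z powr ((- ln r) powr \<kappa>)) | z. 0 < z \<and> z \<le> exp (- exp (- m))}"
proof -
  have "(- ln r) powr \<kappa> = exp (- \<kappa> * linear_coord Power r)" if "r \<in> std_chain Power" for r
    using that by (simp add: powr_def)
  note forms = affine_to_Power[where k = Power and \<kappa> = \<kappa> and \<rho> = "\<lambda>r. (- ln r) powr \<kappa>", OF this]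
  show "affine_maps Power Power \<kappa> 0 UNIV =
     {(\<lambda>r\<in>{0<..<1}. z powr ((- ln r) powr \<kappa>)) | z. 0 < z \<and> z < 1}"
    using forms(1) by (simp only: std_chain.simps)
  show "affine_maps Power Power \<kappa> 0 {..m} =
     {(\<lambda>r\<in>{0<..<1}. z powr ((- ln r) powr \<kappa>)) | z. 0 < z \<and> z \<le> exp (- exp (- m))}"
    using forms(2) by (simp only: std_chain.simps)
qed


section \<open>The translations between two classes\<close>

theorem theorem4p12:
  fixes F R S T :: "'a::qnc_tomonoid set"
    and \<iota> \<phi>\<^sub>R \<phi>\<^sub>S :: "'a \<Rightarrow> real"
    and \<alpha>\<^sub>R \<alpha>\<^sub>S \<kappa> :: real
  assumes nontrivial: "\<exists>a::'a. a \<noteq> 1"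
    and F_filter: "tomonoid_filter F" and F_nontrivial: "F \<noteq> {1}" and F_arch: "archimedean_filter F"
    and classes: "\<forall>Q\<in>filter_classes F. \<exists>I \<phi>. real_interval I \<and> order_isomorphism \<phi> Q I"
    and no_min: "\<not> (\<exists>m\<in>F. \<forall>x\<in>F. m \<le> x)"
    and F_ident: "filter_identification F \<iota>"
    and R: "R \<in> filter_classes F" and T: "T \<in> filter_classes F"
    and T_less: "class_less T F"
    and maximal: "maximal_pair F R T"
    and S: "S = class_mult F R T"
    and \<kappa>: "\<kappa> = \<alpha>\<^sub>S / \<alpha>\<^sub>R"
  shows
    "(identified F \<iota> Lukasiewicz R \<phi>\<^sub>R \<alpha>\<^sub>R \<and> identified F \<iota> Lukasiewicz S \<phi>\<^sub>S \<alpha>\<^sub>S \<longrightarrow>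
        (\<exists>m\<in>{-\<kappa>..min (1 - \<kappa>) 0}.
           real_translations Lukasiewicz T R \<phi>\<^sub>R \<phi>\<^sub>S =
             {(\<lambda>r\<in>{0..1}. max (\<kappa> * r + z) 0) | z. -\<kappa> \<le> z \<and> z \<le> m}))
     \<and>
     (identified F \<iota> Lukasiewicz R \<phi>\<^sub>R \<alpha>\<^sub>R \<and> identified F \<iota> ReversedProduct S \<phi>\<^sub>S \<alpha>\<^sub>S \<longrightarrow>
        (\<exists>m\<in>{-1..0}.
           real_translations Lukasiewicz T R \<phi>\<^sub>R \<phi>\<^sub>S =
             {(\<lambda>r\<in>{0..1}. max (1 - exp (-\<kappa> * (r + z))) 0) | z. -1 \<le> z \<and> z \<le> m}))
     \<and>
     (identified F \<iota> Product R \<phi>\<^sub>R \<alpha>\<^sub>R \<and> identified F \<iota> Lukasiewicz S \<phi>\<^sub>S \<alpha>\<^sub>S \<longrightarrow>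
        (\<exists>m\<in>{0..1}.
           real_translations Product T R \<phi>\<^sub>R \<phi>\<^sub>S =
             {(\<lambda>r\<in>{0<..1}. max (\<kappa> * ln r + z) 0) | z. 0 \<le> z \<and> z \<le> m}))
     \<and>
     (identified F \<iota> Product R \<phi>\<^sub>R \<alpha>\<^sub>R \<and> identified F \<iota> Product S \<phi>\<^sub>S \<alpha>\<^sub>S \<longrightarrow>
        (\<exists>m\<in>{0<..1}.
           real_translations Product T R \<phi>\<^sub>R \<phi>\<^sub>S =
             {(\<lambda>r\<in>{0<..1}. z * r powr \<kappa>) | z. 0 < z \<and> z \<le> m}))
     \<and>
     (identified F \<iota> Product R \<phi>\<^sub>R \<alpha>\<^sub>R \<and> identified F \<iota> ReversedProduct S \<phi>\<^sub>S \<alpha>\<^sub>S \<longrightarrow>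
        real_translations Product T R \<phi>\<^sub>R \<phi>\<^sub>S =
          {(\<lambda>r\<in>{0<..1}. max (1 - 1 / (z * r powr \<kappa>)) 0) | z. 1 \<le> z} \<or>
        (\<exists>m\<ge>1.
           real_translations Product T R \<phi>\<^sub>R \<phi>\<^sub>S =
             {(\<lambda>r\<in>{0<..1}. max (1 - 1 / (z * r powr \<kappa>)) 0) | z. 1 \<le> z \<and> z \<le> m}))
     \<and>
     (identified F \<iota> Product R \<phi>\<^sub>R \<alpha>\<^sub>R \<and> identified F \<iota> Power S \<phi>\<^sub>S \<alpha>\<^sub>S \<longrightarrow>
        real_translations Product T R \<phi>\<^sub>R \<phi>\<^sub>S =
          {(\<lambda>r\<in>{0<..1}. z powr (r powr (-\<kappa>))) | z. 0 < z \<and> z < 1} \<or>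
        (\<exists>m\<in>{0<..<1}.
           real_translations Product T R \<phi>\<^sub>R \<phi>\<^sub>S =
             {(\<lambda>r\<in>{0<..1}. z powr (r powr (-\<kappa>))) | z. 0 < z \<and> z \<le> m}))
     \<and>
     (identified F \<iota> ReversedProduct R \<phi>\<^sub>R \<alpha>\<^sub>R \<and> identified F \<iota> ReversedProduct S \<phi>\<^sub>S \<alpha>\<^sub>S \<longrightarrow>
        trivial_translations T R S \<or>
        (\<exists>m\<in>{0<..1}.
           real_translations ReversedProduct T R \<phi>\<^sub>R \<phi>\<^sub>S \<subseteq>
             {(\<lambda>r\<in>{0..<1}. max (1 - (1 - r) powr \<kappa> / z) 0) | z. 0 < z \<and> z \<le> m}))
     \<and>
     (identified F \<iota> Power R \<phi>\<^sub>R \<alpha>\<^sub>R \<and> identified F \<iota> ReversedProduct S \<phi>\<^sub>S \<alpha>\<^sub>S \<longrightarrow>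
        trivial_translations T R S \<or>
        real_translations Power T R \<phi>\<^sub>R \<phi>\<^sub>S \<subseteq>
          {(\<lambda>r\<in>{0<..<1}. max (1 - (- ln r) powr \<kappa> / z) 0) | z. 0 < z} \<or>
        (\<exists>m>0.
           real_translations Power T R \<phi>\<^sub>R \<phi>\<^sub>S \<subseteq>
             {(\<lambda>r\<in>{0<..<1}. max (1 - (- ln r) powr \<kappa> / z) 0) | z. 0 < z \<and> z \<le> m}))
     \<and>
     (identified F \<iota> Power R \<phi>\<^sub>R \<alpha>\<^sub>R \<and> identified F \<iota> Power S \<phi>\<^sub>S \<alpha>\<^sub>S \<longrightarrow>
        real_translations Power T R \<phi>\<^sub>R \<phi>\<^sub>S =
          {(\<lambda>r\<in>{0<..<1}. z powr ((- ln r) powr \<kappa>)) | z. 0 < z \<and> z < 1} \<or>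
        (\<exists>m\<in>{0<..<1}.
           real_translations Power T R \<phi>\<^sub>R \<phi>\<^sub>S =
             {(\<lambda>r\<in>{0<..<1}. z powr ((- ln r) powr \<kappa>)) | z. 0 < z \<and> z \<le> m}))"

proof (intro conjI impI)
  have pair: "identified_pair F R T S \<iota> k l \<phi>\<^sub>R \<phi>\<^sub>S \<alpha>\<^sub>R \<alpha>\<^sub>S"
    if "identified F \<iota> k R \<phi>\<^sub>R \<alpha>\<^sub>R \<and> identified F \<iota> l S \<phi>\<^sub>S \<alpha>\<^sub>S" for k l
    using that F_filter F_ident R T maximal S by unfold_locales auto

  show "\<exists>m\<in>{-\<kappa>..min (1 - \<kappa>) 0}. real_translations Lukasiewicz T R \<phi>\<^sub>R \<phi>\<^sub>S =
      {(\<lambda>r\<in>{0..1}. max (\<kappa> * r + z) 0) | z. -\<kappa> \<le> z \<and> z \<le> m}"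
    if "identified F \<iota> Lukasiewicz R \<phi>\<^sub>R \<alpha>\<^sub>R \<and> identified F \<iota> Lukasiewicz S \<phi>\<^sub>S \<alpha>\<^sub>S"
  proof -
    interpret identified_pair F R T S \<iota> Lukasiewicz Lukasiewicz \<phi>\<^sub>R \<phi>\<^sub>S \<alpha>\<^sub>R \<alpha>\<^sub>S
      by (rule pair[OF that])
    obtain Z where Z: "real_translations Lukasiewicz T R \<phi>\<^sub>R \<phi>\<^sub>S =
        affine_maps Lukasiewicz Lukasiewicz \<kappa> 1 Z"
      "Z = {0..1} \<or> (\<exists>m\<in>{0..1}. Z = {z \<in> {0..1}. z \<le> m})" "\<forall>z\<in>Z. z \<le> \<kappa>"
      using real_translations_affine[of 1] \<kappa> by auto
    obtain m where m: "m \<in> {0..1}" "Z = {0..m}"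
      using principal_down_set_unit[OF Z(2)] by blast
    then have "m - \<kappa> \<in> {-\<kappa>..min (1 - \<kappa>) 0}" using Z(3) by auto
    then show ?thesis
      using Z(1) unfolding m(2) affine_Lukasiewicz_Lukasiewicz by blast
  qed

  show "\<exists>m\<in>{-1..0}. real_translations Lukasiewicz T R \<phi>\<^sub>R \<phi>\<^sub>S =
      {(\<lambda>r\<in>{0..1}. max (1 - exp (-\<kappa> * (r + z))) 0) | z. -1 \<le> z \<and> z \<le> m}"
    if "identified F \<iota> Lukasiewicz R \<phi>\<^sub>R \<alpha>\<^sub>R \<and> identified F \<iota> ReversedProduct S \<phi>\<^sub>S \<alpha>\<^sub>S"
  proof -
    interpret identified_pair F R T S \<iota> Lukasiewicz ReversedProduct \<phi>\<^sub>R \<phi>\<^sub>S \<alpha>\<^sub>R \<alpha>\<^sub>S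
      by (rule pair[OF that])
    obtain Z where Z: "real_translations Lukasiewicz T R \<phi>\<^sub>R \<phi>\<^sub>S =
        affine_maps Lukasiewicz ReversedProduct \<kappa> 1 Z"
      "Z = {0..} \<or> (\<exists>m\<in>{0..}. Z = {z \<in> {0..}. z \<le> m})" "\<forall>z\<in>Z. z \<le> \<kappa>"
      using real_translations_affine[of 1] \<kappa> by auto
    have "\<kappa> > 0" using ratio_pos \<kappa> by simp
    \<comment> \<open>The bottom element of \<open>R\<close> excludes the unbounded alternative.\<close>
    have "\<kappa> + 1 \<notin> Z" using Z(3) by fastforce
    then have "Z \<noteq> {0..}" using \<open>\<kappa> > 0\<close> by auto
    then obtain m where m: "0 \<le> m" "Z = {0..m}" using Z(2) by fastforce
    then have "m / \<kappa> - 1 \<in> {-1..0}" using Z(3) \<open>\<kappa> > 0\<close> by (auto simp: field_simps)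
    then show ?thesis
      using Z(1) unfolding m(2) affine_Lukasiewicz_ReversedProduct[OF \<open>\<kappa> > 0\<close>] by blast
  qed

  show "\<exists>m\<in>{0..1}. real_translations Product T R \<phi>\<^sub>R \<phi>\<^sub>S =
      {(\<lambda>r\<in>{0<..1}. max (\<kappa> * ln r + z) 0) | z. 0 \<le> z \<and> z \<le> m}"
    if "identified F \<iota> Product R \<phi>\<^sub>R \<alpha>\<^sub>R \<and> identified F \<iota> Lukasiewicz S \<phi>\<^sub>S \<alpha>\<^sub>S"
  proof -
    interpret identified_pair F R T S \<iota> Product Lukasiewicz \<phi>\<^sub>R \<phi>\<^sub>S \<alpha>\<^sub>R \<alpha>\<^sub>S
      by (rule pair[OF that])
    obtain Z where Z: "real_translations Product T R \<phi>\<^sub>R \<phi>\<^sub>S =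
        affine_maps Product Lukasiewicz \<kappa> 0 Z"
      "Z = {0..1} \<or> (\<exists>m\<in>{0..1}. Z = {z \<in> {0..1}. z \<le> m})"
      using real_translations_affine[of 0] \<kappa> by auto
    obtain m where m: "m \<in> {0..1}" "Z = {0..m}"
      using principal_down_set_unit[OF Z(2)] by blast
    then show ?thesis using Z(1) unfolding m(2) affine_Product_Lukasiewicz by blast
  qed

  show "\<exists>m\<in>{0<..1}. real_translations Product T R \<phi>\<^sub>R \<phi>\<^sub>S =
      {(\<lambda>r\<in>{0<..1}. z * r powr \<kappa>) | z. 0 < z \<and> z \<le> m}"
    if "identified F \<iota> Product R \<phi>\<^sub>R \<alpha>\<^sub>R \<and> identified F \<iota> Product S \<phi>\<^sub>S \<alpha>\<^sub>S"
  proof -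
    interpret identified_pair F R T S \<iota> Product Product \<phi>\<^sub>R \<phi>\<^sub>S \<alpha>\<^sub>R \<alpha>\<^sub>S
      by (rule pair[OF that])
    obtain Z where Z: "real_translations Product T R \<phi>\<^sub>R \<phi>\<^sub>S =
        affine_maps Product Product \<kappa> 0 Z"
      "Z = {..0} \<or> (\<exists>m\<in>{..0}. Z = {z \<in> {..0}. z \<le> m})"
      using real_translations_affine[of 0] \<kappa> by auto
    have "\<exists>m\<le>0. Z = {..m}"
      using Z(2) by fastforce
    then obtain m where m: "m \<le> 0" "Z = {..m}" by blast
    then have "exp m \<in> {0<..1}" by simp
    then show ?thesis using Z(1) unfolding m(2) affine_Product_Product by blast
  qed

  show "real_translations Product T R \<phi>\<^sub>R \<phi>\<^sub>S =
      {(\<lambda>r\<in>{0<..1}. max (1 - 1 / (z * r powr \<kappa>)) 0) | z. 1 \<le> z} \<or>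
    (\<exists>m\<ge>1. real_translations Product T R \<phi>\<^sub>R \<phi>\<^sub>S =
      {(\<lambda>r\<in>{0<..1}. max (1 - 1 / (z * r powr \<kappa>)) 0) | z. 1 \<le> z \<and> z \<le> m})"
    if "identified F \<iota> Product R \<phi>\<^sub>R \<alpha>\<^sub>R \<and> identified F \<iota> ReversedProduct S \<phi>\<^sub>S \<alpha>\<^sub>S"
  proof -
    interpret identified_pair F R T S \<iota> Product ReversedProduct \<phi>\<^sub>R \<phi>\<^sub>S \<alpha>\<^sub>R \<alpha>\<^sub>S
      by (rule pair[OF that])
    obtain Z where Z: "real_translations Product T R \<phi>\<^sub>R \<phi>\<^sub>S =
        affine_maps Product ReversedProduct \<kappa> 0 Z"
      "Z = {0..} \<or> (\<exists>m\<in>{0..}. Z = {z \<in> {0..}. z \<le> m})"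
      using real_translations_affine[of 0] \<kappa> by auto
    from Z(2) consider "Z = {0..}" | m where "0 \<le> m" "Z = {0..m}" by fastforce
    then show ?thesis
    proof cases
      case 1
      then show ?thesis using Z(1) unfolding 1 affine_Product_ReversedProduct by blast
    next
      case (2 m)
      then have "exp m \<ge> 1" by simp
      then show ?thesis using Z(1) unfolding 2(2) affine_Product_ReversedProduct by blast
    qed
  qed

  show "real_translations Product T R \<phi>\<^sub>R \<phi>\<^sub>S =
      {(\<lambda>r\<in>{0<..1}. z powr (r powr (-\<kappa>))) | z. 0 < z \<and> z < 1} \<or>
    (\<exists>m\<in>{0<..<1}. real_translations Product T R \<phi>\<^sub>R \<phi>\<^sub>S =
      {(\<lambda>r\<in>{0<..1}. z powr (r powr (-\<kappa>))) | z. 0 < z \<and> z \<le> m})"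
    if "identified F \<iota> Product R \<phi>\<^sub>R \<alpha>\<^sub>R \<and> identified F \<iota> Power S \<phi>\<^sub>S \<alpha>\<^sub>S"
  proof -
    interpret identified_pair F R T S \<iota> Product Power \<phi>\<^sub>R \<phi>\<^sub>S \<alpha>\<^sub>R \<alpha>\<^sub>S
      by (rule pair[OF that])
    obtain Z where Z: "real_translations Product T R \<phi>\<^sub>R \<phi>\<^sub>S = affine_maps Product Power \<kappa> 0 Z"
      "Z = UNIV \<or> (\<exists>m. Z = {..m})"
      using real_translations_affine[of 0] \<kappa> by (auto simp: atMost_def)
    from Z(2) show ?thesis
    proof
      assume "Z = UNIV"
      then show ?thesis using Z(1) affine_Product_Power(1) by blast
    next
      assume "\<exists>m. Z = {..m}"
      then obtain m where m: "Z = {..m}" by blast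
      have "exp (- exp (- m)) \<in> {0<..<1}" by simp
      then show ?thesis using Z(1) unfolding m affine_Product_Power(2) by blast
    qed
  qed

  show "trivial_translations T R S \<or> (\<exists>m\<in>{0<..1}.
      real_translations ReversedProduct T R \<phi>\<^sub>R \<phi>\<^sub>S \<subseteq>
        {(\<lambda>r\<in>{0..<1}. max (1 - (1 - r) powr \<kappa> / z) 0) | z. 0 < z \<and> z \<le> m})"
    if "identified F \<iota> ReversedProduct R \<phi>\<^sub>R \<alpha>\<^sub>R \<and> identified F \<iota> ReversedProduct S \<phi>\<^sub>S \<alpha>\<^sub>S"
  proof (rule disj_imp[THEN iffD2, OF impI])
    assume nontriv: "\<not> trivial_translations T R S"
    interpret identified_pair F R T S \<iota> ReversedProduct ReversedProduct \<phi>\<^sub>R \<phi>\<^sub>S \<alpha>\<^sub>R \<alpha>\<^sub>S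
      by (rule pair[OF that])
    obtain C where C: "real_translations ReversedProduct T R \<phi>\<^sub>R \<phi>\<^sub>S =
        (\<lambda>c. \<lambda>r\<in>{0..<1}. 1 - exp (- max (\<kappa> * linear_coord ReversedProduct r + c) 0)) ` C"
      "\<forall>c\<in>C. c \<le> 0"
      using real_translations_topless nontriv \<kappa> by auto
    have "1 - exp (- max (\<kappa> * linear_coord ReversedProduct r + c) 0) =
        max (1 - (1 - r) powr \<kappa> / exp c) 0" if "r \<in> {0..<1}" for r c
    proof -
      have "exp (- (\<kappa> * linear_coord ReversedProduct r + c)) = (1 - r) powr \<kappa> / exp c"
        using that by (simp add: powr_def exp_diff)
      then show ?thesis unfolding one_minus_exp_max by simp
    qed
    then have "(\<lambda>r\<in>{0..<1}. 1 - exp (- max (\<kappa> * linear_coord ReversedProduct r + c) 0)) =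
        (\<lambda>r\<in>{0..<1}. max (1 - (1 - r) powr \<kappa> / exp c) 0)" for c
      by (intro restrict_ext)
    then have "real_translations ReversedProduct T R \<phi>\<^sub>R \<phi>\<^sub>S \<subseteq>
        {(\<lambda>r\<in>{0..<1}. max (1 - (1 - r) powr \<kappa> / z) 0) | z. 0 < z \<and> z \<le> 1}"
      unfolding C(1) using C(2) by force
    then show "\<exists>m\<in>{0<..1}. real_translations ReversedProduct T R \<phi>\<^sub>R \<phi>\<^sub>S \<subseteq>
        {(\<lambda>r\<in>{0..<1}. max (1 - (1 - r) powr \<kappa> / z) 0) | z. 0 < z \<and> z \<le> m}"
      by (intro bexI[of _ 1]) auto
  qed

  show "trivial_translations T R S \<or>
    real_translations Power T R \<phi>\<^sub>R \<phi>\<^sub>S \<subseteq>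
      {(\<lambda>r\<in>{0<..<1}. max (1 - (- ln r) powr \<kappa> / z) 0) | z. 0 < z} \<or>
    (\<exists>m>0. real_translations Power T R \<phi>\<^sub>R \<phi>\<^sub>S \<subseteq>
      {(\<lambda>r\<in>{0<..<1}. max (1 - (- ln r) powr \<kappa> / z) 0) | z. 0 < z \<and> z \<le> m})"
    if "identified F \<iota> Power R \<phi>\<^sub>R \<alpha>\<^sub>R \<and> identified F \<iota> ReversedProduct S \<phi>\<^sub>S \<alpha>\<^sub>S"
  proof (rule disj_imp[THEN iffD2, OF impI])
    assume nontriv: "\<not> trivial_translations T R S"
    interpret identified_pair F R T S \<iota> Power ReversedProduct \<phi>\<^sub>R \<phi>\<^sub>S \<alpha>\<^sub>R \<alpha>\<^sub>S
      by (rule pair[OF that])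
    obtain C where C: "real_translations Power T R \<phi>\<^sub>R \<phi>\<^sub>S =
        (\<lambda>c. \<lambda>r\<in>{0<..<1}. 1 - exp (- max (\<kappa> * linear_coord Power r + c) 0)) ` C"
      using real_translations_topless nontriv \<kappa> by auto
    have "1 - exp (- max (\<kappa> * linear_coord Power r + c) 0) =
        max (1 - (- ln r) powr \<kappa> / exp c) 0" if "r \<in> {0<..<1}" for r c
    proof -
      have "exp (- (\<kappa> * linear_coord Power r + c)) = (- ln r) powr \<kappa> / exp c"
        using that by (simp add: powr_def exp_diff)
      then show ?thesis unfolding one_minus_exp_max by simp
    qed
    then have "(\<lambda>r\<in>{0<..<1}. 1 - exp (- max (\<kappa> * linear_coord Power r + c) 0)) =
        (\<lambda>r\<in>{0<..<1}. max (1 - (- ln r) powr \<kappa> / exp c) 0)" for c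
      by (intro restrict_ext)
    then have "real_translations Power T R \<phi>\<^sub>R \<phi>\<^sub>S \<subseteq>
        {(\<lambda>r\<in>{0<..<1}. max (1 - (- ln r) powr \<kappa> / z) 0) | z. 0 < z}"
      unfolding C(1) by force
    then show "real_translations Power T R \<phi>\<^sub>R \<phi>\<^sub>S \<subseteq>
        {(\<lambda>r\<in>{0<..<1}. max (1 - (- ln r) powr \<kappa> / z) 0) | z. 0 < z} \<or>
      (\<exists>m>0. real_translations Power T R \<phi>\<^sub>R \<phi>\<^sub>S \<subseteq>
        {(\<lambda>r\<in>{0<..<1}. max (1 - (- ln r) powr \<kappa> / z) 0) | z. 0 < z \<and> z \<le> m})" ..
  qed

  show "real_translations Power T R \<phi>\<^sub>R \<phi>\<^sub>S =
      {(\<lambda>r\<in>{0<..<1}. z powr ((- ln r) powr \<kappa>)) | z. 0 < z \<and> z < 1} \<or>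
    (\<exists>m\<in>{0<..<1}. real_translations Power T R \<phi>\<^sub>R \<phi>\<^sub>S =
      {(\<lambda>r\<in>{0<..<1}. z powr ((- ln r) powr \<kappa>)) | z. 0 < z \<and> z \<le> m})"
    if "identified F \<iota> Power R \<phi>\<^sub>R \<alpha>\<^sub>R \<and> identified F \<iota> Power S \<phi>\<^sub>S \<alpha>\<^sub>S"
  proof -
    interpret identified_pair F R T S \<iota> Power Power \<phi>\<^sub>R \<phi>\<^sub>S \<alpha>\<^sub>R \<alpha>\<^sub>S
      by (rule pair[OF that])
    have no_cut: "cut_off Power = (\<lambda>u. u)" by (rule ext) simp
    \<comment> \<open>Here \<open>R\<close> has no top element; \<open>0\<close> is an arbitrary reference point.\<close>
    obtain Z where Z: "real_translations Power T R \<phi>\<^sub>R \<phi>\<^sub>S = affine_maps Power Power \<kappa> 0 Z"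
      "Z = UNIV \<or> (\<exists>m. Z = {..m})"
      using real_translations_affine[of 0] \<kappa> no_cut by (auto simp: atMost_def)
    from Z(2) show ?thesis
    proof
      assume "Z = UNIV"
      then show ?thesis using Z(1) affine_Power_Power(1) by blast
    next
      assume "\<exists>m. Z = {..m}"
      then obtain m where m: "Z = {..m}" by blast
      have "exp (- exp (- m)) \<in> {0<..<1}" by simp
      then show ?thesis using Z(1) unfolding m affine_Power_Power(2) by blast
    qed
  qed
qed

end
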